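(* Let $d\ge1$ and let $M\subseteq\mathbb{R}^d$ be a nonempty multirectangle. Every nontrivial subgroup of $\operatorname{Rec}_d(M)$ that is normalized by the derived subgroup $D(\operatorname{Rec}_d(M))$ contains $D(\operatorname{Rec}_d(M))$. In particular, $D(\operatorname{Rec}_d(M))$ is a simple group, and it is contained in every nontrivial normal subgroup of $\operatorname{Rec}_d(M)$.
   Context: A rectangle in $\mathbb{R}^d$ is a set $\prod_{i=1}^d[a_i,b_i)$ with $a_i<b_i$ real numbers. A multirectangle is a finite union of rectangles. For a multirectangle $M\subseteq\mathbb{R}^d$, $\operatorname{Rec}_d(M)$ denotes the group, under composition, of all bijections $f:M\to M$ for which there exists a finite partition of $M$ into rectangles such that the restriction of $f$ to each piece is a translation. $D(G)$ denotes the derived (commutator) subgroup of a group $G$. *)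

theory Defs
  imports "HOL-Analysis.Analysis" "HOL-Algebra.Solvable_Groups"
begin

definition rectangle :: "(real^'n) set \<Rightarrow> bool" where
  "rectangle R \<longleftrightarrow> (\<exists>a b. (\<forall>i. a$i < b$i) \<and> R = {x. \<forall>i. a$i \<le> x$i \<and> x$i < b$i})"

definition multirectangle :: "(real^'n) set \<Rightarrow> bool" where
  "multirectangle M \<longleftrightarrow> (\<exists>F. finite F \<and> (\<forall>R\<in>F. rectangle R) \<and> M = \<Union>F)"

text \<open>Rec_d(M): bijections of M that are piecewise translations on a finite partition of M
  into rectangles. Elements are represented as functions on all of R^d that are the
  identity outside M (so that composition is the group operation).\<close>

definition Rec :: "(real^'n) set \<Rightarrow> (real^'n \<Rightarrow> real^'n) set" where
  "Rec M = {f. bij_betw f M M \<and> (\<forall>x. x \<notin> M \<longrightarrow> f x = x) \<and>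
     (\<exists>P. finite P \<and> (\<forall>R\<in>P. rectangle R) \<and> \<Union>P = M \<and>
          (\<forall>R\<in>P. \<forall>S\<in>P. R \<noteq> S \<longrightarrow> R \<inter> S = {}) \<and>
          (\<forall>R\<in>P. \<exists>v. \<forall>x\<in>R. f x = x + v))}"

definition RecGroup :: "(real^'n) set \<Rightarrow> (real^'n \<Rightarrow> real^'n) monoid" where
  "RecGroup M = \<lparr>carrier = Rec M, mult = (\<circ>), one = id\<rparr>"

text \<open>Simplicity for possibly infinite groups (the library's simple_group
  requires finite order > 1, which is unsuitable here).\<close>

definition simple_grp :: "('a, 'b) monoid_scheme \<Rightarrow> bool" where
  "simple_grp G \<longleftrightarrow> group G \<and> carrier G \<noteq> {\<one>\<^bsub>G\<^esub>} \<and>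
     (\<forall>N. N \<lhd> G \<longrightarrow> N = {\<one>\<^bsub>G\<^esub>} \<or> N = carrier G)"

end

theory Submission
  imports Defs
begin

text \<open>Call an involution in Rec(M) a flip if it exchanges a multirectangle X with a disjoint
  multirectangle and is the identity elsewhere, and let T be the normal subgroup generated by the
  flips. The theorem follows from D(Rec(M)) = T and the fact that T lies in every nontrivial
  subgroup H normalized by D(Rec(M)).

  The key tool is that a multirectangle embeds by a piecewise translation into any multirectangle
  of larger volume. With it, any f can be corrected by flips, one small piece at a time, so that
  its support lies in a prescribed U. Taking U with a disjoint translate in M, two elements modulo
  T can be given disjoint supports, so Rec(M)/T is abelian and D(Rec(M)) is contained in T.
  Conversely a flip of a rectangle is a commutator of two flips supported in the same place
  (cut the rectangle into halves). If f in H displaces R, then H contains all commutators of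
  elements of D(Rec(M)) supported in R, and flips of small rectangles can be moved into R.\<close>

subsection \<open>The ring of multirectangles\<close>

text \<open>The embedding tool asks for strictly larger volume because equal volume is not enough: a
  unit square and a rectangle with sides sqrt 2 and 1 / sqrt 2 cannot be cut into finitely many
  axis-parallel rectangles that match by translations. The slack in volume lets a single dyadic grid
  approximate both sets well enough, and it is why small pieces and spare room occur throughout.

  Flips are convenient because an embedding of X into M that moves X off itself only has to be
  inverted on its image to become an element of Rec(M); nothing is matched outside.

  Since H is normalized only by D(Rec(M)), every conjugation applied to H must be by an element
  already known to lie in D(Rec(M)). Hence the inclusion of T in D(Rec(M)) comes before the study of
  H: T supplies the elements that move small supports.\<close>

lemma rectangle_Int:
  assumes "rectangle R" "rectangle S" "R \<inter> S \<noteq> {}"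
  shows "rectangle (R \<inter> S)"
proof -
  obtain a b where R: "R = {x. \<forall>i. a$i \<le> x$i \<and> x$i < b$i}"
    using assms(1) unfolding rectangle_def by blast
  obtain c d where S: "S = {x. \<forall>i. c$i \<le> x$i \<and> x$i < d$i}"
    using assms(2) unfolding rectangle_def by blast
  obtain x where "x \<in> R" "x \<in> S" using assms(3) by blast
  then have "\<forall>i. max (a$i) (c$i) < min (b$i) (d$i)"
    unfolding R S by (auto intro: order_le_less_trans)
  then show ?thesis
    unfolding rectangle_def R S
    by (intro exI[of _ "\<chi> i. max (a$i) (c$i)"] exI[of _ "\<chi> i. min (b$i) (d$i)"]) auto
qed

lemma rectangle_Int_less:
  fixes R :: "(real^'n) set"
  assumes "rectangle R" "R \<inter> {x. x$k < c} \<noteq> {}"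
  shows "rectangle (R \<inter> {x. x$k < c})"
proof -
  obtain a b where R: "R = {x. \<forall>i. a$i \<le> x$i \<and> x$i < b$i}"
    using assms(1) unfolding rectangle_def by blast
  obtain x where x: "x \<in> R" "x$k < c" using assms(2) by blast
  have lt: "a$i < (if i = k then min (b$i) c else b$i)" for i
    using x(2) x(1)[unfolded R, simplified, rule_format, of i] by auto
  have "R \<inter> {x. x$k < c} = {x. \<forall>i. a$i \<le> x$i \<and> x$i < (\<chi> i. if i = k then min (b$i) c else b$i)$i}"
    unfolding R by (auto split: if_splits)
  with lt show ?thesis
    unfolding rectangle_def
    by (intro exI[of _ a] exI[of _ "\<chi> i. if i = k then min (b$i) c else b$i"]) auto
qed

lemma rectangle_Int_ge:
  fixes R :: "(real^'n) set"
  assumes "rectangle R" "R \<inter> {x. c \<le> x$k} \<noteq> {}"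
  shows "rectangle (R \<inter> {x. c \<le> x$k})"
proof -
  obtain a b where R: "R = {x. \<forall>i. a$i \<le> x$i \<and> x$i < b$i}"
    using assms(1) unfolding rectangle_def by blast
  obtain x where x: "x \<in> R" "c \<le> x$k" using assms(2) by blast
  have lt: "(if i = k then max (a$i) c else a$i) < b$i" for i
    using x(2) x(1)[unfolded R, simplified, rule_format, of i] by auto
  have "R \<inter> {x. c \<le> x$k} = {x. \<forall>i. (\<chi> i. if i = k then max (a$i) c else a$i)$i \<le> x$i \<and> x$i < b$i}"
    unfolding R by (auto split: if_splits)
  with lt show ?thesis
    unfolding rectangle_def
    by (intro exI[of _ "\<chi> i. if i = k then max (a$i) c else a$i"] exI[of _ b]) auto
qed

text \<open>For subtracting a rectangle: when \<open>K\<close> lists its faces, each piece lies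
  inside it or misses it.\<close>

lemma rectangle_split_halfspaces:
  fixes R :: "(real^'n) set"
  assumes "finite K" "rectangle R"
  shows "\<exists>P. finite P \<and> (\<forall>S\<in>P. rectangle S) \<and> disjoint P \<and> \<Union>P = R \<and>
           (\<forall>S\<in>P. \<forall>(k,c)\<in>K. S \<subseteq> {x. x$k < c} \<or> S \<subseteq> {x. c \<le> x$k})"
  using assms(1)
proof (induction K rule: finite_induct)
  case empty
  show ?case by (rule exI[of _ "{R}"]) (simp add: assms(2))
next
  case (insert p K)
  obtain k c where p: "p = (k,c)" by (cases p)
  obtain P where P: "finite P" "\<forall>S\<in>P. rectangle S" "disjoint P" "\<Union>P = R"
    "\<forall>S\<in>P. \<forall>(k,c)\<in>K. S \<subseteq> {x. x$k < c} \<or> S \<subseteq> {x. c \<le> x$k}"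
    using insert.IH by blast
  \<comment> \<open>A rectangle is nonempty by definition, so empty halves are discarded.\<close>
  define Q where "Q = ((\<lambda>S. S \<inter> {x. x$k < c}) ` P \<union> (\<lambda>S. S \<inter> {x. c \<le> x$k}) ` P) - {{}}"
  have "\<forall>S\<in>Q. rectangle S"
    unfolding Q_def using P(2) rectangle_Int_less rectangle_Int_ge by blast
  moreover have "disjoint Q"
    using P(3) unfolding Q_def disjoint_def by (auto 0 4)
  moreover have "\<Union>Q = R"
  proof (intro equalityI subsetI)
    fix x assume "x \<in> R"
    then obtain S where "S \<in> P" "x \<in> S" using P(4) by blast
    then have "x \<in> S \<inter> {x. x$k < c} \<or> x \<in> S \<inter> {x. c \<le> x$k}" by auto
    with \<open>S \<in> P\<close> show "x \<in> \<Union>Q" unfolding Q_def by blast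
  next
    fix x assume "x \<in> \<Union>Q"
    then show "x \<in> R" unfolding Q_def P(4)[symmetric] by blast
  qed
  moreover have "\<forall>S\<in>Q. \<forall>(k,c)\<in>insert p K. S \<subseteq> {x. x$k < c} \<or> S \<subseteq> {x. c \<le> x$k}"
  proof (intro ballI)
    fix S q assume "S \<in> Q" and q: "q \<in> insert p K"
    then obtain S' where S': "S' \<in> P" "S = S' \<inter> {x. x$k < c} \<or> S = S' \<inter> {x. c \<le> x$k}"
      unfolding Q_def by blast
    show "case q of (k,c) \<Rightarrow> S \<subseteq> {x. x$k < c} \<or> S \<subseteq> {x. c \<le> x$k}"
    proof (cases "q = p")
      case True
      then show ?thesis using S'(2) p by auto
    next
      case False
      with q have "q \<in> K" by blast
      then have "case q of (k,c) \<Rightarrow> S' \<subseteq> {x. x$k < c} \<or> S' \<subseteq> {x. c \<le> x$k}"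
        using P(5) S'(1) by blast
      then show ?thesis using S'(2) by (cases q) auto
    qed
  qed
  moreover have "finite Q" unfolding Q_def using P(1) by simp
  ultimately show ?case by blast
qed

text \<open>Rectangles are nonempty, so the empty set is added to obtain a semiring of sets. The
  ring that it generates then provides unions, intersections, differences and disjoint covers of
  multirectangles.\<close>

lemma rectangle_semiring: "semiring_of_sets UNIV (insert {} (Collect rectangle))"
proof
  fix R S :: "(real^'n) set"
  assume "R \<in> insert {} (Collect rectangle)" "S \<in> insert {} (Collect rectangle)"
  then show "R \<inter> S \<in> insert {} (Collect rectangle)"
    using rectangle_Int by auto
next
  fix R S :: "(real^'n) set"
  assume R: "R \<in> insert {} (Collect rectangle)" and S: "S \<in> insert {} (Collect rectangle)"
  show "\<exists>C\<subseteq>insert {} (Collect rectangle). finite C \<and> disjoint C \<and> R - S = \<Union>C"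
  proof (cases "R = {} \<or> S = {}")
    case True
    then show ?thesis by (intro exI[of _ "{R}"]) (use R in auto)
  next
    case False
    with R S have RS: "rectangle R" "rectangle S" by auto
    obtain c d where S: "S = {x. \<forall>i. c$i \<le> x$i \<and> x$i < d$i}"
      using RS(2) unfolding rectangle_def by blast
    define K where "K = (\<lambda>i. (i, c$i)) ` UNIV \<union> (\<lambda>i. (i, d$i)) ` UNIV"
    have "finite K" unfolding K_def by simp
    from rectangle_split_halfspaces[OF this RS(1)] obtain P where
      P: "finite P" "\<forall>S\<in>P. rectangle S" "disjoint P" "\<Union>P = R"
      "\<forall>S\<in>P. \<forall>(k,c)\<in>K. S \<subseteq> {x. x$k < c} \<or> S \<subseteq> {x. c \<le> x$k}" by blast
    \<comment> \<open>\<open>K\<close> consists of the faces of \<open>S\<close>, so a piece lies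
      beyond one of them or on the inner side of all.\<close>
    have dich: "p \<subseteq> S \<or> p \<inter> S = {}" if "p \<in> P" for p
    proof -
      have 1: "p \<subseteq> {x. x$i < c$i} \<or> p \<subseteq> {x. c$i \<le> x$i}"
           "p \<subseteq> {x. x$i < d$i} \<or> p \<subseteq> {x. d$i \<le> x$i}" for i
        using P(5)[rule_format, OF that, of "(i, c$i)"] P(5)[rule_format, OF that, of "(i, d$i)"]
        unfolding K_def by auto
      show ?thesis
      proof (cases "\<exists>i. p \<subseteq> {x. x$i < c$i} \<or> p \<subseteq> {x. d$i \<le> x$i}")
        case True
        then obtain i where "p \<subseteq> {x. x$i < c$i} \<or> p \<subseteq> {x. d$i \<le> x$i}" ..
        then have "p \<inter> S = {}" unfolding S
          by (auto dest!: subsetD spec[of _ i])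
        then show ?thesis ..
      next
        case False
        then have "p \<subseteq> S" using 1 unfolding S by blast
        then show ?thesis ..
      qed
    qed
    have "R - S = \<Union>{p\<in>P. p \<inter> S = {}}"
      using dich P(4) by blast
    moreover have "disjoint {p\<in>P. p \<inter> S = {}}" using P(3) unfolding disjoint_def by blast
    ultimately show ?thesis using P(1,2)
      by (intro exI[of _ "{p\<in>P. p \<inter> S = {}}"]) auto
  qed
qed auto

text \<open>The generated ring consists of finite disjoint unions, while the rectangles in a
  multirectangle may overlap; closure of the ring under finite unions makes the two notions
  agree.\<close>

lemma multirectangle_iff_generated_ring:
  "multirectangle M \<longleftrightarrow> M \<in> semiring_of_sets.generated_ring (insert {} (Collect rectangle))"
    (is "_ \<longleftrightarrow> M \<in> ?G")
proof
  note gen = semiring_of_sets.generated_ring_def[OF rectangle_semiring]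
  assume "M \<in> ?G"
  then obtain C where C: "C \<subseteq> insert {} (Collect rectangle)" "finite C" "M = \<Union>C"
    unfolding gen by blast
  then show "multirectangle M"
    unfolding multirectangle_def by (intro exI[of _ "C - {{}}"]) auto
next
  assume "multirectangle M"
  then obtain F where F: "finite F" "\<forall>R\<in>F. rectangle R" "M = \<Union>F"
    unfolding multirectangle_def by blast
  from F(2) have "F \<subseteq> ?G"
    using semiring_of_sets.generated_ringI_Basic[OF rectangle_semiring] by blast
  with F(1,3) show "M \<in> ?G"
    using ring_of_sets.finite_Union[OF semiring_of_sets.generating_ring[OF rectangle_semiring]]
    by simp
qed

lemma multirectangle_disjoint_cover:
  assumes "multirectangle M"
  shows "\<exists>P. finite P \<and> (\<forall>R\<in>P. rectangle R) \<and> disjoint P \<and> \<Union>P = M"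
proof -
  obtain C where C: "C \<subseteq> insert {} (Collect rectangle)" "finite C" "disjoint C" "M = \<Union>C"
    using assms
    unfolding multirectangle_iff_generated_ring semiring_of_sets.generated_ring_def[OF rectangle_semiring]
    by blast
  then show ?thesis
    by (intro exI[of _ "C - {{}}"]) (auto simp: disjoint_def)
qed

lemma multirectangle_ring: "ring_of_sets UNIV (Collect (multirectangle :: (real^'n) set \<Rightarrow> bool))"
proof -
  have "Collect (multirectangle :: (real^'n) set \<Rightarrow> bool) = semiring_of_sets.generated_ring (insert {} (Collect rectangle))"
    using multirectangle_iff_generated_ring by blast
  then show ?thesis
    using semiring_of_sets.generating_ring[OF rectangle_semiring] by simp
qed

lemma
  assumes "multirectangle A" "multirectangle B"
  shows multirectangle_Un: "multirectangle (A \<union> B)"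
    and multirectangle_Int: "multirectangle (A \<inter> B)"
    and multirectangle_Diff: "multirectangle (A - B)"
  using assms ring_of_sets.Un[OF multirectangle_ring, of A B]
    ring_of_sets.Diff[OF multirectangle_ring, of A B]
    semiring_of_sets.Int[OF ring_of_sets.axioms(1)[OF multirectangle_ring], of A B]
  by simp_all

lemma multirectangle_empty [simp]: "multirectangle {}"
  unfolding multirectangle_def by (intro exI[of _ "{}"]) auto

lemma multirectangle_rectangle: "rectangle R \<Longrightarrow> multirectangle R"
  unfolding multirectangle_def by (intro exI[of _ "{R}"]) auto

lemma multirectangle_UN:
  assumes "finite I" "\<And>i. i \<in> I \<Longrightarrow> multirectangle (A i)"
  shows "multirectangle (\<Union>i\<in>I. A i)"
  using assms by (induction I rule: finite_induct) (auto intro: multirectangle_Un)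

lemma rectangle_translation:
  fixes R :: "(real^'n) set"
  assumes "rectangle R"
  shows "rectangle ((+) v ` R)"
proof -
  obtain a b where R: "\<forall>i. a$i < b$i" "R = {x. \<forall>i. a$i \<le> x$i \<and> x$i < b$i}"
    using assms unfolding rectangle_def by blast
  have "(+) v ` R = {x. \<forall>i. (v + a)$i \<le> x$i \<and> x$i < (v + b)$i}"
  proof (intro equalityI subsetI)
    fix x assume "x \<in> {x. \<forall>i. (v + a)$i \<le> x$i \<and> x$i < (v + b)$i}"
    then have "x - v \<in> R" unfolding R(2) by (auto simp: algebra_simps)
    then show "x \<in> (+) v ` R" by (metis add.commute diff_add_cancel image_eqI)
  qed (auto simp: R(2))
  with R(1) show ?thesis unfolding rectangle_def
    by (intro exI[of _ "v + a"] exI[of _ "v + b"]) auto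
qed

lemma multirectangle_translation:
  assumes "multirectangle A"
  shows "multirectangle ((+) v ` A)"
proof -
  obtain F where "finite F" "\<forall>R\<in>F. rectangle R" "A = \<Union>F"
    using assms unfolding multirectangle_def by blast
  then show ?thesis unfolding multirectangle_def
    by (intro exI[of _ "(`) ((+) v) ` F"]) (auto simp: rectangle_translation)
qed

lemma multirectangle_contains_rectangle:
  assumes "multirectangle A" "x \<in> A"
  obtains R where "rectangle R" "x \<in> R" "R \<subseteq> A"
  using assms unfolding multirectangle_def by blast

subsection \<open>Piecewise translations\<close>

text \<open>The pieces are the level sets of the displacement \<open>f x - x\<close>, a canonical
  partition: no choice of rectangles is carried along, and restriction, union and composition become
  set algebra. The map need not send \<open>A\<close> to itself, so partial embeddings are
  covered.\<close>

definition piecewise_translation :: "(real^'n) set \<Rightarrow> (real^'n \<Rightarrow> real^'n) \<Rightarrow> bool" where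
  "piecewise_translation A f \<longleftrightarrow>
     finite ((\<lambda>x. f x - x) ` A) \<and> (\<forall>v. multirectangle {x\<in>A. f x - x = v})"

text \<open>The pieces may overlap and several may share a vector: the level set at \<open>u\<close>
  is the union of all \<open>A i\<close> with \<open>v i = u\<close>.\<close>

lemma piecewise_translationI:
  assumes "finite I" "\<And>i. i \<in> I \<Longrightarrow> multirectangle (A i)" "X = (\<Union>i\<in>I. A i)"
    and "\<And>i x. i \<in> I \<Longrightarrow> x \<in> A i \<Longrightarrow> f x = x + v i"
  shows "piecewise_translation X f"
  unfolding piecewise_translation_def
proof (intro conjI allI)
  have "(\<lambda>x. f x - x) ` X \<subseteq> v ` I" using assms(3,4) by auto
  then show "finite ((\<lambda>x. f x - x) ` X)" using assms(1) finite_subset by blast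
  fix u
  have "{x \<in> X. f x - x = u} = (\<Union>i\<in>I. if v i = u then A i else {})"
    using assms(3,4) by (auto split: if_splits)
  then show "multirectangle {x \<in> X. f x - x = u}"
    using assms(1,2) by (auto intro: multirectangle_UN)
qed

lemma image_as_translations:
  fixes f :: "real^'n \<Rightarrow> real^'n"
  shows "f ` A = (\<Union>v\<in>(\<lambda>x. f x - x) ` A. (+) v ` {x\<in>A. f x - x = v})"
proof (intro equalityI subsetI)
  fix y assume "y \<in> f ` A"
  then obtain x where x: "x \<in> A" "y = f x" by blast
  then have "y = (f x - x) + x" by simp
  moreover have "x \<in> {z\<in>A. f z - z = f x - x}" using x(1) by simp
  ultimately have "y \<in> (+) (f x - x) ` {z\<in>A. f z - z = f x - x}" by (rule image_eqI)
  then show "y \<in> (\<Union>v\<in>(\<lambda>x. f x - x) ` A. (+) v ` {x\<in>A. f x - x = v})"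
    by (intro UN_I[of "f x - x"] imageI x(1))
next
  fix y assume "y \<in> (\<Union>v\<in>(\<lambda>x. f x - x) ` A. (+) v ` {x\<in>A. f x - x = v})"
  then obtain v x where x: "x \<in> A" "f x - x = v" "y = v + x" by blast
  then have "y = f x" by auto
  with x(1) show "y \<in> f ` A" by simp
qed

lemma piecewise_translation_domain:
  assumes "piecewise_translation A f"
  shows "multirectangle A"
proof -
  have "multirectangle (\<Union>v\<in>(\<lambda>x. f x - x) ` A. {x\<in>A. f x - x = v})"
    using assms unfolding piecewise_translation_def by (intro multirectangle_UN) simp_all
  also have "(\<Union>v\<in>(\<lambda>x. f x - x) ` A. {x\<in>A. f x - x = v}) = A" by auto
  finally show ?thesis .
qed

lemma piecewise_translation_cong:
  assumes "\<And>x. x \<in> A \<Longrightarrow> f x = g x"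
  shows "piecewise_translation A f \<longleftrightarrow> piecewise_translation A g"
proof -
  have "(\<lambda>x. f x - x) ` A = (\<lambda>x. g x - x) ` A"
    by (rule image_cong) (simp_all add: assms)
  moreover have "{x\<in>A. f x - x = v} = {x\<in>A. g x - x = v}" for v
    by (rule Collect_cong) (simp add: assms cong: conj_cong)
  ultimately show ?thesis unfolding piecewise_translation_def by simp
qed

lemma piecewise_translation_subset:
  assumes "piecewise_translation A f" "multirectangle B" "B \<subseteq> A"
  shows "piecewise_translation B f"
proof (rule piecewise_translationI[where I = "(\<lambda>x. f x - x) ` A" and v = id
      and A = "\<lambda>v. {x\<in>A. f x - x = v} \<inter> B"])
  show "finite ((\<lambda>x. f x - x) ` A)" using assms(1) unfolding piecewise_translation_def by blast
  show "multirectangle ({x\<in>A. f x - x = v} \<inter> B)" for v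
    using assms unfolding piecewise_translation_def by (auto intro: multirectangle_Int)
qed (use assms(3) in \<open>auto simp: algebra_simps\<close>)

lemma piecewise_translation_Un:
  assumes "piecewise_translation A f" "piecewise_translation B f"
  shows "piecewise_translation (A \<union> B) f"
proof (rule piecewise_translationI[where I = "(\<lambda>x. f x - x) ` (A \<union> B)" and v = id
      and A = "\<lambda>v. {x\<in>A. f x - x = v} \<union> {x\<in>B. f x - x = v}"])
  show "finite ((\<lambda>x. f x - x) ` (A \<union> B))"
    using assms unfolding piecewise_translation_def image_Un by blast
  show "multirectangle ({x\<in>A. f x - x = v} \<union> {x\<in>B. f x - x = v})" for v
    using assms unfolding piecewise_translation_def by (auto intro: multirectangle_Un)
qed (auto simp: algebra_simps)

lemma piecewise_translation_id:
  assumes "multirectangle A" "\<And>x. x \<in> A \<Longrightarrow> f x = x"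
  shows "piecewise_translation A f"
  by (rule piecewise_translationI[where I = "{0}" and A = "\<lambda>_. A" and v = "\<lambda>_. 0"]) (use assms in auto)

lemma piecewise_translation_image:
  assumes "piecewise_translation A f"
  shows "multirectangle (f ` A)"
proof -
  have "f ` A = (\<Union>v\<in>(\<lambda>x. f x - x) ` A. (+) v ` {x\<in>A. f x - x = v})"
    by (rule image_as_translations)
  also have "multirectangle \<dots>"
    using assms unfolding piecewise_translation_def
    by (intro multirectangle_UN multirectangle_translation) simp_all
  finally show ?thesis .
qed

lemma piecewise_translation_comp:
  assumes "piecewise_translation A f" "piecewise_translation B g" "f ` A \<subseteq> B"
  shows "piecewise_translation A (g \<circ> f)"
\<comment> \<open>The index \<open>(u,w)\<close> stands for the points that \<open>f\<close> moves
  by \<open>u\<close> into the part of \<open>B\<close> that \<open>g\<close> moves by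
  \<open>w\<close>.\<close>
proof (rule piecewise_translationI[where v = "\<lambda>(u,w). u + w"
      and I = "(\<lambda>x. f x - x) ` A \<times> (\<lambda>x. g x - x) ` B"
      and A = "\<lambda>(u,w). {x\<in>A. f x - x = u} \<inter> (+) (-u) ` {x\<in>B. g x - x = w}"])
  show "finite ((\<lambda>x. f x - x) ` A \<times> (\<lambda>x. g x - x) ` B)"
    using assms(1,2) unfolding piecewise_translation_def by simp
  fix i assume "i \<in> (\<lambda>x. f x - x) ` A \<times> (\<lambda>x. g x - x) ` B"
  obtain u w where i: "i = (u,w)" by (cases i)
  show "multirectangle (case i of (u,w) \<Rightarrow> {x\<in>A. f x - x = u} \<inter> (+) (-u) ` {x\<in>B. g x - x = w})"
    using assms(1,2) unfolding i prod.case piecewise_translation_def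
    by (intro multirectangle_Int multirectangle_translation) simp_all
next
  show "A = (\<Union>i\<in>(\<lambda>x. f x - x) ` A \<times> (\<lambda>x. g x - x) ` B.
     case i of (u,w) \<Rightarrow> {x\<in>A. f x - x = u} \<inter> (+) (-u) ` {x\<in>B. g x - x = w})" (is "A = ?R")
  proof (intro equalityI subsetI)
    fix x assume x: "x \<in> A"
    then have fx: "f x \<in> B" using assms(3) by blast
    have "x = - (f x - x) + f x" by simp
    moreover have "f x \<in> {y\<in>B. g y - y = g (f x) - f x}" using fx by simp
    ultimately have "x \<in> (+) (-(f x - x)) ` {y\<in>B. g y - y = g (f x) - f x}"
      by (rule image_eqI)
    moreover have "x \<in> {y\<in>A. f y - y = f x - x}" using x by simp
    ultimately show "x \<in> ?R"
      using x fx by (intro UN_I[of "(f x - x, g (f x) - f x)"]) simp_all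
  next
    fix x assume "x \<in> ?R"
    then show "x \<in> A" by (elim UN_E) (simp split: prod.splits)
  qed
next
  fix i x assume "x \<in> (case i of (u,w) \<Rightarrow> {x\<in>A. f x - x = u} \<inter> (+) (-u) ` {x\<in>B. g x - x = w})"
  then obtain u w where i: "i = (u,w)"
    and x: "x \<in> {x\<in>A. f x - x = u}" "x \<in> (+) (-u) ` {x\<in>B. g x - x = w}"
    by (cases i) blast
  then obtain y where "x = - u + y" "g y - y = w" by blast
  with i x(1) show "(g \<circ> f) x = x + (case i of (u,w) \<Rightarrow> u + w)"
    by (auto simp: algebra_simps)
qed

lemma piecewise_translation_inverse:
  assumes "piecewise_translation A f" "\<And>x. x \<in> A \<Longrightarrow> g (f x) = x"
  shows "piecewise_translation (f ` A) g"
proof (rule piecewise_translationI[where I = "(\<lambda>x. f x - x) ` A" and v = uminus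
      and A = "\<lambda>v. (+) v ` {x\<in>A. f x - x = v}"])
  show "finite ((\<lambda>x. f x - x) ` A)" using assms(1) unfolding piecewise_translation_def by blast
  show "multirectangle ((+) v ` {x\<in>A. f x - x = v})" for v
    using assms(1) unfolding piecewise_translation_def by (blast intro: multirectangle_translation)
  show "f ` A = (\<Union>v\<in>(\<lambda>x. f x - x) ` A. (+) v ` {x\<in>A. f x - x = v})"
    by (rule image_as_translations)
next
  fix v y assume "y \<in> (+) v ` {x\<in>A. f x - x = v}"
  then obtain x where "x \<in> A" "f x - x = v" "y = v + x" by blast
  then have "g y = g (f x)" "y + - v = x" "x \<in> A" by auto
  then show "g y = y + - v" using assms(2)[of x] by simp
qed

text \<open>Passes between partitions into rectangles and level sets. To recover a partition, each
  of the finitely many level sets is cut into disjoint rectangles; pieces from different levels are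
  disjoint because their displacements differ.\<close>

lemma Rec_iff:
  assumes M: "multirectangle M"
  shows "f \<in> Rec M \<longleftrightarrow> bij_betw f M M \<and> (\<forall>x. x \<notin> M \<longrightarrow> f x = x) \<and> piecewise_translation M f"
    (is "_ \<longleftrightarrow> ?r")
proof
  assume f: "f \<in> Rec M"
  then have "\<exists>P. finite P \<and> (\<forall>R\<in>P. rectangle R) \<and> \<Union>P = M \<and>
          (\<forall>R\<in>P. \<forall>S\<in>P. R \<noteq> S \<longrightarrow> R \<inter> S = {}) \<and>
          (\<forall>R\<in>P. \<exists>v. \<forall>x\<in>R. f x = x + v)"
    unfolding Rec_def by simp
  then obtain P where P: "finite P" "\<forall>R\<in>P. rectangle R" "\<Union>P = M"
    and "\<forall>R\<in>P. \<exists>v. \<forall>x\<in>R. f x = x + v"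
    by (elim exE conjE)
  from this(4) obtain v where v: "\<forall>R\<in>P. \<forall>x\<in>R. f x = x + v R"
    unfolding bchoice_iff by (elim exE)
  have "piecewise_translation M f"
    by (rule piecewise_translationI[where I = P and A = id and v = v])
      (use P v in \<open>simp_all add: multirectangle_rectangle\<close>)
  moreover have "bij_betw f M M" "\<forall>x. x \<notin> M \<longrightarrow> f x = x" using f unfolding Rec_def by simp_all
  ultimately show ?r by simp
next
  assume r: ?r
  have "\<exists>P. finite P \<and> (\<forall>R\<in>P. rectangle R) \<and> disjoint P \<and> \<Union>P = {x\<in>M. f x - x = v}" for v
    by (rule multirectangle_disjoint_cover) (use r in \<open>simp add: piecewise_translation_def\<close>)
  then obtain P where P: "\<And>v. finite (P v)" "\<And>v. \<forall>R\<in>P v. rectangle R"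
    "\<And>v. disjoint (P v)" "\<And>v. \<Union>(P v) = {x\<in>M. f x - x = v}"
    by metis
  define Q where "Q = (\<Union>v\<in>(\<lambda>x. f x - x) ` M. P v)"
  have "finite Q" unfolding Q_def
    by (rule finite_UN_I) (use r P(1) in \<open>simp_all only: piecewise_translation_def\<close>)
  moreover have "\<forall>R\<in>Q. rectangle R" unfolding Q_def using P(2) by blast
  moreover have "\<Union>Q = M" 
  proof -
    have "\<Union>Q = (\<Union>v\<in>(\<lambda>x. f x - x) ` M. \<Union>(P v))" unfolding Q_def by auto
    also have "\<dots> = M" unfolding P(4) by auto
    finally show ?thesis .
  qed
  moreover have "R \<inter> S = {}" if RS: "R \<in> Q" "S \<in> Q" "R \<noteq> S" for R S
  proof -
    obtain u w where u: "R \<in> P u" and w: "S \<in> P w" using RS(1,2) unfolding Q_def by blast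
    show ?thesis
    proof (cases "u = w")
      case True
      then show ?thesis using disjointD[OF P(3)[of u], of R S] u w RS(3) by simp
    next
      case False
      have "R \<subseteq> {x\<in>M. f x - x = u}" "S \<subseteq> {x\<in>M. f x - x = w}"
        using u w P(4) by (metis Union_upper)+
      with False show ?thesis by auto
    qed
  qed
  moreover have "\<exists>v. \<forall>x\<in>R. f x = x + v" if RQ: "R \<in> Q" for R
  proof -
    obtain v where "R \<in> P v" using RQ unfolding Q_def by blast
    then have "R \<subseteq> {x\<in>M. f x - x = v}" using P(4) by (metis Union_upper)
    then show ?thesis by (intro exI[of _ v]) (auto simp: algebra_simps)
  qed
  moreover have "bij_betw f M M" "\<forall>x. x \<notin> M \<longrightarrow> f x = x" using r by simp_all
  ultimately show "f \<in> Rec M" unfolding Rec_def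
    by (intro CollectI conjI exI[of _ Q]) simp_all
qed

subsection \<open>Volume and dyadic approximation\<close>

lemma rectangle_between_boxes:
  fixes a b :: "real^'n"
  shows "box a b \<subseteq> {x. \<forall>i. a$i \<le> x$i \<and> x$i < b$i}"
    and "{x. \<forall>i. a$i \<le> x$i \<and> x$i < b$i} \<subseteq> cbox a b"
  by (auto simp: mem_box_cart less_imp_le)

lemma negligible_frontier_rectangle:
  assumes "rectangle R"
  shows "negligible (frontier R)"
proof -
  obtain a b where R: "R = {x. \<forall>i. a$i \<le> x$i \<and> x$i < b$i}"
    using assms unfolding rectangle_def by (elim exE conjE)
  have "closure R \<subseteq> cbox a b" unfolding R
    by (rule closure_minimal[OF rectangle_between_boxes(2) closed_cbox])
  moreover have "box a b \<subseteq> interior R" unfolding R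
    by (rule interior_maximal[OF rectangle_between_boxes(1) open_box])
  ultimately have "frontier R \<subseteq> cbox a b - box a b"
    unfolding frontier_def by (rule Diff_mono)
  then show ?thesis
    by (rule negligible_subset[OF negligible_frontier_interval])
qed

text \<open>A negligible frontier gives the closure and the interior of \<open>A\<close> the same
  volume as \<open>A\<close>; these two sets control the dyadic approximations from outside and from
  inside.\<close>

lemma multirectangle_Jordan:
  assumes "multirectangle A"
  shows "bounded A \<and> negligible (frontier A)"
proof -
  obtain F where F: "finite F" "\<forall>R\<in>F. rectangle R" "A = \<Union>F"
    using assms unfolding multirectangle_def by (elim exE conjE)
  from F(1,2) have "bounded (\<Union>F) \<and> negligible (frontier (\<Union>F))"
  proof (induction F rule: finite_induct)
    case (insert R F)
    from insert.prems obtain a b where R: "R = {x. \<forall>i. a$i \<le> x$i \<and> x$i < b$i}"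
      unfolding rectangle_def by auto
    have "bounded R" unfolding R
      by (rule bounded_subset[OF bounded_cbox rectangle_between_boxes(2)])
    moreover have "negligible (frontier R)"
      using insert.prems by (simp add: negligible_frontier_rectangle)
    ultimately show ?case using insert
      by (auto intro: negligible_subset[OF _ frontier_Un_subset] negligible_Un)
  qed simp
  then show ?thesis using F(3) by simp
qed

lemma multirectangle_lmeasurable: "multirectangle A \<Longrightarrow> A \<in> lmeasurable"
  by (simp add: measurable_Jordan multirectangle_Jordan)

text \<open>The set lies between the open and the closed box, which have equal volume. If a side is
  degenerate, the set is empty and not a rectangle, so that case is separate.\<close>

lemma measure_half_open_box:
  fixes a b :: "real^'n"
  assumes "\<And>i. a$i \<le> b$i"
  shows "measure lebesgue {x. \<forall>i. a$i \<le> x$i \<and> x$i < b$i} = (\<Prod>i\<in>UNIV. b$i - a$i)"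
proof (cases "\<exists>i. a$i = b$i")
  case True
  then obtain i where i: "a$i = b$i" ..
  then have "{x. \<forall>i. a$i \<le> x$i \<and> x$i < b$i} = {}"
    by (auto intro!: exI[of _ i])
  moreover have "(\<Prod>i\<in>UNIV. b$i - a$i) = 0" using i by (auto intro!: exI[of _ i])
  ultimately show ?thesis by (simp only: measure_empty)
next
  case False
  define R where "R = {x. \<forall>i. a$i \<le> x$i \<and> x$i < b$i}"
  have "rectangle R" unfolding rectangle_def R_def
    using False assms by (auto simp: less_le)
  then have R: "R \<in> lmeasurable" by (simp add: multirectangle_lmeasurable multirectangle_rectangle)
  have "measure lebesgue R \<le> measure lebesgue (cbox a b)"
    by (rule measure_mono_fmeasurable[OF _ fmeasurableD[OF R]])
      (simp_all only: R_def rectangle_between_boxes lmeasurable_cbox)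
  moreover have "measure lebesgue (box a b) \<le> measure lebesgue R"
    by (rule measure_mono_fmeasurable[OF _ _ R])
      (simp_all only: R_def rectangle_between_boxes fmeasurableD lmeasurable_box)
  moreover have "measure lebesgue (box a b) = measure lebesgue (cbox a b)"
    by (simp add: measure_lborel_box_eq measure_lborel_cbox_eq)
  moreover have "measure lebesgue (cbox a b) = (\<Prod>i\<in>UNIV. b$i - a$i)"
  proof -
    have "cbox a b \<noteq> {}" using assms by (simp add: interval_ne_empty_cart)
    from content_cbox_cart[OF this] show ?thesis by simp
  qed
  ultimately show ?thesis unfolding R_def by simp
qed

lemma multirectangle_measure_pos:
  assumes "multirectangle A" "A \<noteq> {}"
  shows "0 < measure lebesgue A"
proof -
  obtain x where "x \<in> A" using assms(2) by blast
  with assms(1) obtain R where R: "rectangle R" "R \<subseteq> A"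
    by (rule multirectangle_contains_rectangle)
  then obtain a b where ab: "\<And>i. a$i < b$i" "R = {x. \<forall>i. a$i \<le> x$i \<and> x$i < b$i}"
    unfolding rectangle_def by auto
  have "0 < (\<Prod>i\<in>UNIV. b$i - a$i)" using ab(1) by (simp add: prod_pos)
  also have "\<dots> = measure lebesgue R"
    unfolding ab(2) by (rule measure_half_open_box[symmetric]) (simp add: ab(1) less_imp_le)
  also have "\<dots> \<le> measure lebesgue A"
    by (rule measure_mono_fmeasurable)
      (use R assms(1) in \<open>auto simp: multirectangle_lmeasurable multirectangle_rectangle fmeasurableD\<close>)
  finally show ?thesis .
qed

section \<open>The dyadic grid and the counting of its cells\<close>

definition dyadic_index :: "nat \<Rightarrow> real^'n \<Rightarrow> 'n \<Rightarrow> int" where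
  "dyadic_index k x = (\<lambda>i. \<lfloor>2^k * x$i\<rfloor>)"

text \<open>A half-open cube of side \<open>1/2^k\<close>, encoded as a fibre of
  \<open>dyadic_index\<close> so that the cells of one level partition the space by
  construction.\<close>

definition dyadic_cell :: "nat \<Rightarrow> ('n \<Rightarrow> int) \<Rightarrow> (real^'n) set" where
  "dyadic_cell k z = {x. dyadic_index k x = z}"

lemma dyadic_cell_eq:
  "dyadic_cell k z = {x::real^'n. \<forall>i. (\<chi> i. z i / 2^k)$i \<le> x$i \<and> x$i < (\<chi> i. (z i + 1) / 2^k)$i}"
  unfolding dyadic_cell_def dyadic_index_def
  by (auto simp: fun_eq_iff floor_eq_iff field_simps)

lemma rectangle_dyadic_cell: "rectangle (dyadic_cell k z)"
  unfolding rectangle_def dyadic_cell_eq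
  by (intro exI[of _ "\<chi> i. z i / 2^k"] exI[of _ "\<chi> i. (z i + 1) / 2^k"])
    (simp add: divide_strict_right_mono)

lemma measure_dyadic_cell:
  "measure lebesgue (dyadic_cell k (z :: 'n::finite \<Rightarrow> int)) = (1/2^k) ^ CARD('n)"
  unfolding dyadic_cell_eq
  by (subst measure_half_open_box) (simp_all add: divide_right_mono diff_divide_distrib[symmetric])

lemma finite_dyadic_index:
  fixes A :: "(real^'n) set"
  assumes "bounded A"
  shows "finite (dyadic_index k ` A)"
proof -
  obtain B where B: "\<And>x. x \<in> A \<Longrightarrow> norm x \<le> B"
    using assms unfolding bounded_iff by auto
  have "dyadic_index k x i \<in> {\<lfloor>- (2^k * B)\<rfloor>..\<lfloor>2^k * B\<rfloor>}" if "x \<in> A" for x i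
  proof -
    have "\<bar>x$i\<bar> \<le> B" using B[OF that] component_le_norm_cart[of x i] by simp
    then have "- B \<le> x$i" "x$i \<le> B" by auto
    then have "2^k * (- B) \<le> 2^k * x$i" "2^k * x$i \<le> 2^k * B" by (simp_all only: mult_left_mono zero_le_power zero_le_numeral)
    then show ?thesis unfolding dyadic_index_def by (auto intro: floor_mono)
  qed
  then have "dyadic_index k ` A \<subseteq> PiE UNIV (\<lambda>_. {\<lfloor>- (2^k * B)\<rfloor>..\<lfloor>2^k * B\<rfloor>})"
    unfolding PiE_UNIV_domain by blast
  then show ?thesis by (rule finite_subset) (simp add: finite_PiE)
qed

lemma dyadic_cells_disjoint: "disjoint_family_on (dyadic_cell k) Z"
  unfolding disjoint_family_on_def dyadic_cell_def by auto

lemma measure_dyadic_cells: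
  fixes Z :: "('n::finite \<Rightarrow> int) set"
  assumes "finite Z"
  shows "measure lebesgue (\<Union>z\<in>Z. dyadic_cell k z) = card Z * (1/2^k) ^ CARD('n)"
proof -
  have "dyadic_cell k z \<in> lmeasurable" for z :: "'n \<Rightarrow> int"
    by (simp add: multirectangle_lmeasurable multirectangle_rectangle rectangle_dyadic_cell)
  then have "measure lebesgue (\<Union>z\<in>Z. dyadic_cell k z) = (\<Sum>z\<in>Z. measure lebesgue (dyadic_cell k z))"
    by (intro measure_finite_Union assms dyadic_cells_disjoint image_subsetI)
      (simp_all only: fmeasurableD fmeasurableD2 infinity_ennreal_def not_False_eq_True)
  then show ?thesis by (simp add: measure_dyadic_cell)
qed

text \<open>The index at level \<open>k\<close> is half the index at level \<open>Suc k\<close>,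
  rounded down, so each grid refines the previous one. This makes the approximations below
  monotone.\<close>

lemma dyadic_index_mono:
  assumes "dyadic_index (Suc k) x = dyadic_index (Suc k) y"
  shows "dyadic_index k x = dyadic_index k y"
proof -
  have "dyadic_index k w i = dyadic_index (Suc k) w i div 2" for w :: "real^'a" and i
    using floor_divide_real_eq_div[of 2 "2 * 2^k * w$i"] by (simp add: dyadic_index_def)
  then show ?thesis using assms by (simp add: fun_eq_iff)
qed

lemma dyadic_index_dist:
  fixes x y :: "real^'n"
  assumes "dyadic_index k x = dyadic_index k y"
  shows "dist x y \<le> CARD('n) / 2^k"
proof -
  have "\<bar>(x - y)$i\<bar> \<le> 1 / 2^k" for i
  proof -
    have "\<lfloor>2^k * x$i\<rfloor> = \<lfloor>2^k * y$i\<rfloor>" using assms unfolding dyadic_index_def by meson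
    then have "\<bar>2^k * x$i - 2^k * y$i\<bar> \<le> 1" by linarith
    then have "2^k * \<bar>x$i - y$i\<bar> \<le> 1" by (simp add: abs_mult right_diff_distrib[symmetric])
    then show ?thesis by (simp add: field_simps)
  qed
  then have "(\<Sum>i\<in>UNIV. \<bar>(x - y)$i\<bar>) \<le> CARD('n) * (1 / 2^k)"
    by (intro sum_bounded_above) simp
  then show ?thesis using norm_le_l1_cart[of "x - y"] by (simp add: dist_norm)
qed

lemma dyadic_scale_small:
  assumes "0 < (e::real)"
  obtains k where "c / 2^k < e"
proof -
  have "(\<lambda>k. c * (1/2)^k) \<longlonglongrightarrow> c * 0"
    by (intro tendsto_mult tendsto_const LIMSEQ_power_zero) simp
  then have "eventually (\<lambda>k. c * (1/2)^k < e) sequentially"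
    using assms by (auto dest: order_tendstoD(2)[where a = e])
  then obtain k where "c * (1/2)^k < e" by (auto simp: eventually_sequentially)
  then show thesis by (intro that[of k]) (simp add: power_one_over)
qed

text \<open>Let \<open>S k\<close> be the union of the cells that meet \<open>A\<close>, and
  \<open>J k\<close> that of the cells inside \<open>B\<close>. The sets \<open>S k\<close> decrease
  to a subset of the closure of \<open>A\<close>, and the sets \<open>J k\<close> increase to a set
  containing the interior of \<open>B\<close>. As frontiers are negligible, the limits of the
  volumes keep the strict inequality, which therefore holds at some finite level; dividing by the
  common cell volume compares the numbers of cells.\<close>

lemma dyadic_counting:
  fixes A B :: "(real^'n) set"
  assumes A: "multirectangle A" and B: "multirectangle B"
    and less: "measure lebesgue A < measure lebesgue B"
  obtains k where "card (dyadic_index k ` A) \<le> card {z \<in> dyadic_index k ` B. dyadic_cell k z \<subseteq> B}"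
proof -
  define Z where "Z k = {z \<in> dyadic_index k ` B. dyadic_cell k z \<subseteq> B}" for k
  define S where "S k = (\<Union>z\<in>dyadic_index k ` A. dyadic_cell k z)" for k
  define J where "J k = (\<Union>z\<in>Z k. dyadic_cell k z)" for k
  have S: "x \<in> S k \<longleftrightarrow> (\<exists>y\<in>A. dyadic_index k x = dyadic_index k y)" for x k
    unfolding S_def dyadic_cell_def by auto
  have J: "x \<in> J k \<longleftrightarrow> (\<forall>y. dyadic_index k y = dyadic_index k x \<longrightarrow> y \<in> B)" for x k
    unfolding J_def Z_def dyadic_cell_def by auto
  have finA: "finite (dyadic_index k ` A)" for k
    using A by (simp add: finite_dyadic_index multirectangle_Jordan)
  have finZ: "finite (Z k)" for k
    using B by (simp add: Z_def finite_dyadic_index multirectangle_Jordan)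
  have cell: "multirectangle (dyadic_cell k z)" for k and z :: "'n \<Rightarrow> int"
    by (rule multirectangle_rectangle[OF rectangle_dyadic_cell])
  have Sm: "S k \<in> lmeasurable" for k
    unfolding S_def by (intro multirectangle_lmeasurable multirectangle_UN finA cell)
  have Jm: "J k \<in> lmeasurable" for k
    unfolding J_def by (intro multirectangle_lmeasurable multirectangle_UN finZ cell)
  have "decseq S"
    unfolding decseq_Suc_iff
  proof (intro allI subsetI)
    fix k x assume "x \<in> S (Suc k)"
    then obtain y where "y \<in> A" "dyadic_index (Suc k) x = dyadic_index (Suc k) y" unfolding S ..
    from this(1) dyadic_index_mono[OF this(2)] show "x \<in> S k" unfolding S ..
  qed
  then have "(\<lambda>k. measure lebesgue (S k)) \<longlonglongrightarrow> measure lebesgue (\<Inter>k. S k)"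
    by (intro Lim_measure_decseq image_subsetI)
      (simp_all only: fmeasurableD[OF Sm] fmeasurableD2[OF Sm] infinity_ennreal_def not_False_eq_True)
  moreover have "measure lebesgue (\<Inter>k. S k) \<le> measure lebesgue A"
  proof -
    have "(\<Inter>k. S k) \<subseteq> closure A"
    proof
      fix x assume x: "x \<in> (\<Inter>k. S k)"
      have "\<exists>y\<in>A. dist y x < e" if "0 < e" for e
      proof -
        obtain k where k: "CARD('n) / 2^k < e" using \<open>0 < e\<close> by (rule dyadic_scale_small)
        have "x \<in> S k" using x by blast
        then obtain y where "y \<in> A" "dyadic_index k x = dyadic_index k y" unfolding S by blast
        with dyadic_index_dist[of k x y] k show ?thesis by (auto simp: dist_commute intro!: bexI[of _ y])
      qed
      then show "x \<in> closure A" unfolding closure_approachable by blast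
    qed
    then have "measure lebesgue (\<Inter>k. S k) \<le> measure lebesgue (closure A)"
      by (rule measure_mono_fmeasurable)
        (use Sm A in \<open>auto simp: fmeasurableD lmeasurable_closure multirectangle_Jordan\<close>)
    also have "\<dots> = measure lebesgue A" using A by (intro measure_closure) (simp_all add: multirectangle_Jordan)
    finally show ?thesis .
  qed
  moreover have "incseq J"
    unfolding incseq_Suc_iff
  proof (intro allI subsetI)
    fix k x assume x: "x \<in> J k"
    show "x \<in> J (Suc k)" unfolding J
    proof (intro allI impI)
      fix y assume "dyadic_index (Suc k) y = dyadic_index (Suc k) x"
      from dyadic_index_mono[OF this] x show "y \<in> B" unfolding J by simp
    qed
  qed
  then have "(\<lambda>k. measure lebesgue (J k)) \<longlonglongrightarrow> measure lebesgue (\<Union>k. J k)"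
  proof (intro Lim_measure_incseq)
    show "range J \<subseteq> sets lebesgue" using Jm by (auto simp: fmeasurableD)
    have "(\<Union>k. J k) \<subseteq> B" by (auto simp: J)
    then have "emeasure lebesgue (\<Union>k. J k) \<le> emeasure lebesgue B"
      using B by (intro emeasure_mono) (auto simp: fmeasurableD multirectangle_lmeasurable)
    then show "emeasure lebesgue (\<Union>k. J k) \<noteq> \<infinity>"
      using fmeasurableD2[OF multirectangle_lmeasurable[OF B]] by (auto simp: top_unique)
  qed
  moreover have "measure lebesgue B \<le> measure lebesgue (\<Union>k. J k)"
  proof -
    have "interior B \<subseteq> (\<Union>k. J k)"
    proof
      fix x assume "x \<in> interior B"
      then obtain e where e: "0 < e" "ball x e \<subseteq> B" unfolding mem_interior by blast
      obtain k where k: "CARD('n) / 2^k < e" using \<open>0 < e\<close> by (rule dyadic_scale_small)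
      have "x \<in> J k" unfolding J
      proof (intro allI impI)
        fix y assume "dyadic_index k y = dyadic_index k x"
        with dyadic_index_dist[of k x y] k have "y \<in> ball x e" by simp
        then show "y \<in> B" using e(2) by blast
      qed
      then show "x \<in> (\<Union>k. J k)" by blast
    qed
    moreover have "(\<Union>k. J k) \<in> lmeasurable"
    proof (rule fmeasurableI2[OF multirectangle_lmeasurable[OF B]])
      show "(\<Union>k. J k) \<subseteq> B" by (auto simp: J)
      show "(\<Union>k. J k) \<in> sets lebesgue" using Jm by (auto simp: fmeasurableD)
    qed
    ultimately have "measure lebesgue (interior B) \<le> measure lebesgue (\<Union>k. J k)"
      by (intro measure_mono_fmeasurable)
        (use B in \<open>auto simp: fmeasurableD lmeasurable_interior multirectangle_Jordan\<close>)
    moreover have "measure lebesgue (interior B) = measure lebesgue B"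
      using B by (intro measure_interior) (simp_all add: multirectangle_Jordan)
    ultimately show ?thesis by simp
  qed
  ultimately have lim: "(\<lambda>k. measure lebesgue (J k) - measure lebesgue (S k)) \<longlonglongrightarrow>
       measure lebesgue (\<Union>k. J k) - measure lebesgue (\<Inter>k. S k)"
    and "0 < measure lebesgue (\<Union>k. J k) - measure lebesgue (\<Inter>k. S k)"
    using less by (auto intro: tendsto_diff)
  then have "eventually (\<lambda>k. 0 < measure lebesgue (J k) - measure lebesgue (S k)) sequentially"
    by (rule order_tendstoD(1))
  then obtain k where "measure lebesgue (S k) < measure lebesgue (J k)"
    by (auto simp: eventually_sequentially)
  then have "card (dyadic_index k ` A) * (1/2^k) ^ CARD('n) < card (Z k) * (1/2^k::real) ^ CARD('n)"
    unfolding S_def J_def by (simp only: measure_dyadic_cells finA finZ)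
  then have "card (dyadic_index k ` A) \<le> card (Z k)"
    by (simp add: mult_less_cancel_right_pos)
  then show thesis unfolding Z_def by (rule that)
qed

text \<open>For a fine enough dyadic grid, A meets no more cells than B contains, so that the cells of A
  can be moved injectively onto cells inside B.\<close>

lemma piecewise_translation_embedding:
  fixes A B :: "(real^'n) set"
  assumes A: "multirectangle A" and B: "multirectangle B"
    and less: "measure lebesgue A < measure lebesgue B"
  obtains \<phi> where "piecewise_translation A \<phi>" "inj_on \<phi> A" "\<phi> ` A \<subseteq> B"
proof -
  obtain k where k: "card (dyadic_index k ` A) \<le> card {z \<in> dyadic_index k ` B. dyadic_cell k z \<subseteq> B}"
    using A B less by (rule dyadic_counting)
  have finA: "finite (dyadic_index k ` A)"
    using A by (simp add: finite_dyadic_index multirectangle_Jordan)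
  have "finite {z \<in> dyadic_index k ` B. dyadic_cell k z \<subseteq> B}"
    using B by (simp add: finite_dyadic_index multirectangle_Jordan)
  from card_le_inj[OF finA this k] obtain j
    where j: "j ` (dyadic_index k ` A) \<subseteq> {z \<in> dyadic_index k ` B. dyadic_cell k z \<subseteq> B}"
      and inj: "inj_on j (dyadic_index k ` A)" by blast
  \<comment> \<open>The translation that carries cell \<open>z\<close> onto cell
    \<open>j z\<close>.\<close>
  define v where "v z = (\<chi> i. (j z i - z i) / 2^k)" for z
  define \<phi> where "\<phi> x = x + v (dyadic_index k x)" for x
  \<comment> \<open>Thus \<open>\<phi>\<close> acts on indices as \<open>j\<close>. Points of
    \<open>A\<close> with equal images have equal indices, as \<open>j\<close> is injective, hence
    the same translation vector; so they are equal.\<close>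
  have idx: "dyadic_index k (\<phi> x) = j (dyadic_index k x)" for x
  proof
    fix i
    have "2^k * \<phi> x $ i = 2^k * x$i + real_of_int (j (dyadic_index k x) i - dyadic_index k x i)"
      by (simp add: \<phi>_def v_def distrib_left)
    then have "\<lfloor>2^k * \<phi> x $ i\<rfloor> = \<lfloor>2^k * x$i\<rfloor> + (j (dyadic_index k x) i - dyadic_index k x i)"
      by (simp only: floor_add_int)
    then show "dyadic_index k (\<phi> x) i = j (dyadic_index k x) i"
      by (simp add: dyadic_index_def)
  qed
  show thesis
  proof (rule that)
    show "piecewise_translation A \<phi>"
    proof (rule piecewise_translationI[where I = "dyadic_index k ` A" and v = v
          and A = "\<lambda>z. A \<inter> dyadic_cell k z"])
      show "multirectangle (A \<inter> dyadic_cell k z)" for z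
        by (intro multirectangle_Int A multirectangle_rectangle rectangle_dyadic_cell)
    qed (auto simp: finA dyadic_cell_def \<phi>_def)
    show "inj_on \<phi> A"
    proof (rule inj_onI)
      fix x y assume xy: "x \<in> A" "y \<in> A" "\<phi> x = \<phi> y"
      then have "j (dyadic_index k x) = j (dyadic_index k y)" by (metis idx)
      then have "dyadic_index k x = dyadic_index k y"
        using inj xy(1,2) by (auto dest: inj_onD)
      with xy(3) show "x = y" by (simp add: \<phi>_def)
    qed
    show "\<phi> ` A \<subseteq> B"
    proof
      fix y assume "y \<in> \<phi> ` A"
      then obtain x where x: "x \<in> A" "y = \<phi> x" by blast
      then have "dyadic_cell k (j (dyadic_index k x)) \<subseteq> B" using j by blast
      moreover have "y \<in> dyadic_cell k (j (dyadic_index k x))"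
        unfolding dyadic_cell_def using idx x(2) by simp
      ultimately show "y \<in> B" by blast
    qed
  qed
qed

text \<open>Allows an arbitrary multirectangle to be treated piece by piece, with each piece as
  small as the available room demands.\<close>

lemma multirectangle_small_partition:
  fixes A :: "(real^'n) set"
  assumes A: "multirectangle A" and e: "0 < (e::real)"
  shows "\<exists>P. finite P \<and> (\<forall>R\<in>P. rectangle R \<and> measure lebesgue R < e) \<and> disjoint P \<and> \<Union>P = A"
proof -
  obtain k where k: "1 / 2^k < e" using e by (rule dyadic_scale_small)
  obtain P where P: "finite P" "\<forall>R\<in>P. rectangle R" "disjoint P" "\<Union>P = A"
    using multirectangle_disjoint_cover[OF A] by auto
  define Q where "Q = (\<lambda>(R,z). R \<inter> dyadic_cell k z) ` (P \<times> dyadic_index k ` A) - {{}}"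
  have Q: "\<exists>R z. R \<in> P \<and> S = R \<inter> dyadic_cell k z \<and> S \<noteq> {}" if "S \<in> Q" for S
    using that unfolding Q_def by auto
  have "finite Q" unfolding Q_def
    using A P(1) by (simp add: finite_dyadic_index multirectangle_Jordan)
  moreover have "rectangle S \<and> measure lebesgue S < e" if S: "S \<in> Q" for S
  proof -
    obtain R z where R: "R \<in> P" "S = R \<inter> dyadic_cell k z" "S \<noteq> {}" using Q[OF S] by blast
    then have rect: "rectangle S" using P(2) rectangle_Int rectangle_dyadic_cell by metis
    have "measure lebesgue S \<le> measure lebesgue (dyadic_cell k z)"
      by (rule measure_mono_fmeasurable)
        (simp_all add: R(2) fmeasurableD multirectangle_lmeasurable multirectangle_rectangle
          rectangle_dyadic_cell rect[unfolded R(2)])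
    \<comment> \<open>The dimension is at least 1 and the side at most 1, so the volume of a cell is
      at most its side.\<close>
    also have "\<dots> \<le> (1/2^k) ^ 1"
      unfolding measure_dyadic_cell by (rule power_decreasing) (simp_all add: Suc_leI)
    also have "\<dots> < e" using k by simp
    finally show ?thesis using rect by blast
  qed
  moreover have "disjoint Q"
  proof (rule disjointI)
    fix S S' assume S: "S \<in> Q" "S' \<in> Q" "S \<noteq> S'"
    obtain R z where R: "R \<in> P" "S = R \<inter> dyadic_cell k z" using Q[OF S(1)] by blast
    obtain R' z' where R': "R' \<in> P" "S' = R' \<inter> dyadic_cell k z'" using Q[OF S(2)] by blast
    show "S \<inter> S' = {}"
    proof (cases "R = R'")
      case True
      with R R' S(3) have "z \<noteq> z'" by blast
      then show ?thesis unfolding R(2) R'(2) dyadic_cell_def by auto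
    next
      case False
      then have "R \<inter> R' = {}" using P(3) R(1) R'(1) by (simp add: disjointD)
      then show ?thesis unfolding R(2) R'(2) by blast
    qed
  qed
  moreover have "\<Union>Q = A"
  proof (intro equalityI subsetI)
    fix x assume "x \<in> \<Union>Q"
    then show "x \<in> A" unfolding Q_def P(4)[symmetric] by auto
  next
    fix x assume x: "x \<in> A"
    then obtain R where "R \<in> P" "x \<in> R" using P(4) by blast
    then have "R \<inter> dyadic_cell k (dyadic_index k x) \<in> Q" "x \<in> R \<inter> dyadic_cell k (dyadic_index k x)"
      using x unfolding Q_def dyadic_cell_def by auto
    then show "x \<in> \<Union>Q" by blast
  qed
  ultimately show ?thesis by blast
qed

text \<open>Only an inequality, since the translated pieces may overlap when \<open>f\<close> is not
  injective; the later volume estimates call for an upper bound.\<close>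

lemma measure_piecewise_translation_image_le:
  assumes f: "piecewise_translation A f"
  shows "measure lebesgue (f ` A) \<le> measure lebesgue A"
proof -
  let ?L = "\<lambda>v. {x\<in>A. f x - x = v}" and ?V = "(\<lambda>x. f x - x) ` A"
  have fin: "finite ?V" and mL: "multirectangle (?L v)" for v
    using f by (simp_all add: piecewise_translation_def)
  have "measure lebesgue (f ` A) = measure lebesgue (\<Union>v\<in>?V. (+) v ` ?L v)"
    by (subst image_as_translations) (rule refl)
  also have "\<dots> \<le> (\<Sum>v\<in>?V. measure lebesgue ((+) v ` ?L v))"
    by (rule measure_UNION_le[OF fin])
      (rule fmeasurableD[OF multirectangle_lmeasurable[OF multirectangle_translation[OF mL]]])
  also have "\<dots> = (\<Sum>v\<in>?V. measure lebesgue (?L v))" by (simp only: measure_translation)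
  also have "\<dots> = measure lebesgue (\<Union>v\<in>?V. ?L v)"
  proof (rule measure_finite_Union[symmetric, OF fin])
    show "?L ` ?V \<subseteq> sets lebesgue"
      by (rule image_subsetI) (rule fmeasurableD[OF multirectangle_lmeasurable[OF mL]])
    show "disjoint_family_on ?L ?V" unfolding disjoint_family_on_def by auto
    show "emeasure lebesgue (?L v) \<noteq> \<infinity>" for v
      using fmeasurableD2[OF multirectangle_lmeasurable[OF mL]] by simp
  qed
  also have "(\<Union>v\<in>?V. ?L v) = A" by auto
  finally show ?thesis .
qed

lemma multirectangle_measure_mono:
  "multirectangle A \<Longrightarrow> multirectangle B \<Longrightarrow> A \<subseteq> B \<Longrightarrow> measure lebesgue A \<le> measure lebesgue B"
  by (rule measure_mono_fmeasurable) (simp_all only: fmeasurableD multirectangle_lmeasurable)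

lemma multirectangle_measure_Un_le:
  "multirectangle A \<Longrightarrow> multirectangle B \<Longrightarrow>
    measure lebesgue (A \<union> B) \<le> measure lebesgue A + measure lebesgue B"
  by (rule measure_Un_le) (simp_all only: fmeasurableD multirectangle_lmeasurable)

lemma multirectangle_measure_Diff_ge:
  assumes "multirectangle A" "multirectangle B"
  shows "measure lebesgue A - measure lebesgue B \<le> measure lebesgue (A - B)"
proof -
  have "measure lebesgue A \<le> measure lebesgue ((A - B) \<union> B)"
    by (rule multirectangle_measure_mono) (auto intro: assms multirectangle_Un multirectangle_Diff)
  also have "\<dots> \<le> measure lebesgue (A - B) + measure lebesgue B"
    by (rule multirectangle_measure_Un_le) (auto intro: assms multirectangle_Diff)
  finally show ?thesis by simp
qed

text \<open>Serves twice: a rectangle in \<open>M\<close> supplies a set with a disjoint translate,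
  and a flip of a rectangle is split along the halves to become a commutator.\<close>

lemma rectangle_halves:
  fixes R :: "(real^'n) set"
  assumes "rectangle R"
  obtains U v where "rectangle U" "(+) v ` U \<inter> U = {}" "U \<union> (+) v ` U = R"
proof -
  obtain a b where ab: "\<And>i. a$i < b$i" "R = {x. \<forall>i. a$i \<le> x$i \<and> x$i < b$i}"
    using assms unfolding rectangle_def by auto
  \<comment> \<open>The index type is nonempty, so there is a coordinate \<open>k\<close> across
    which to cut.\<close>
  obtain k :: 'n where True by blast
  define w where "w = (b$k - a$k) / 2"
  define c where "c = (\<chi> i. if i = k then a$k + w else b$i)"
  define U where "U = {x. \<forall>i. a$i \<le> x$i \<and> x$i < c$i}"
  have w: "0 < w" "a$k + w + w = b$k" using ab(1)[of k] by (simp_all add: w_def field_simps)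
  have img: "x \<in> (+) (axis k w) ` U \<longleftrightarrow> x - axis k w \<in> U" for x
  proof
    assume "x \<in> (+) (axis k w) ` U"
    then show "x - axis k w \<in> U" by (elim imageE) simp
  next
    assume "x - axis k w \<in> U"
    then show "x \<in> (+) (axis k w) ` U" by (rule rev_image_eqI) simp
  qed
  have mem_U: "x \<in> U \<longleftrightarrow> x \<in> R \<and> x$k < a$k + w" for x
  proof -
    have "x \<in> U \<longleftrightarrow> (\<forall>i. a$i \<le> x$i \<and> x$i < b$i \<and> (i = k \<longrightarrow> x$k < a$k + w))"
      unfolding U_def mem_Collect_eq
    proof (intro all_cong1)
      fix i
      show "(a$i \<le> x$i \<and> x$i < c$i) \<longleftrightarrow> (a$i \<le> x$i \<and> x$i < b$i \<and> (i = k \<longrightarrow> x$k < a$k + w))"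
        using w by (cases "i = k") (auto simp: c_def)
    qed
    then show ?thesis unfolding ab(2) by auto
  qed
  have mem_V: "x \<in> (+) (axis k w) ` U \<longleftrightarrow> x \<in> R \<and> a$k + w \<le> x$k" for x
  proof -
    have "x \<in> (+) (axis k w) ` U \<longleftrightarrow> (\<forall>i. a$i \<le> (x - axis k w)$i \<and> (x - axis k w)$i < c$i)"
      unfolding img by (simp add: U_def)
    also have "\<dots> \<longleftrightarrow> (\<forall>i. a$i \<le> x$i \<and> x$i < b$i \<and> (i = k \<longrightarrow> a$k + w \<le> x$k))"
    proof (intro all_cong1)
      fix i
      show "(a$i \<le> (x - axis k w)$i \<and> (x - axis k w)$i < c$i) \<longleftrightarrow>
          (a$i \<le> x$i \<and> x$i < b$i \<and> (i = k \<longrightarrow> a$k + w \<le> x$k))"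
        using w by (cases "i = k") (auto simp: axis_def c_def)
    qed
    finally show ?thesis unfolding ab(2) by auto
  qed
  show thesis
  proof (rule that)
    show "rectangle U" unfolding rectangle_def U_def
      using ab(1) w by (intro exI[of _ a] exI[of _ c]) (simp add: c_def)
    show "(+) (axis k w) ` U \<inter> U = {}" unfolding set_eq_iff Int_iff mem_U mem_V by auto
    show "U \<union> (+) (axis k w) ` U = R" unfolding set_eq_iff Un_iff mem_U mem_V by auto
  qed
qed

section \<open>Commuting maps and cosets of a normal subgroup\<close>

lemma disjoint_supports_commute:
  assumes "inj a" "inj b" "\<And>x. x \<notin> A \<Longrightarrow> a x = x" "\<And>x. x \<notin> B \<Longrightarrow> b x = x" "A \<inter> B = {}"
  shows "a \<circ> b = b \<circ> a"
proof
  fix x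
  \<comment> \<open>An injective map that is the identity off \<open>A\<close> keeps
    \<open>A\<close> invariant: if \<open>a y\<close> were outside \<open>A\<close>, then
    \<open>a (a y) = a y\<close>, and so \<open>a y = y\<close>.\<close>
  have A: "a y \<in> A" if "y \<in> A" for y using assms(1,3) that by (metis injD)
  have B: "b y \<in> B" if "y \<in> B" for y using assms(2,4) that by (metis injD)
  consider "x \<in> A" "x \<notin> B" "a x \<notin> B" | "x \<notin> A" "x \<in> B" "b x \<notin> A" | "x \<notin> A" "x \<notin> B"
    using A[of x] B[of x] assms(5) by blast
  then show "(a \<circ> b) x = (b \<circ> a) x"
    by cases (simp_all add: assms(3,4))
qed

text \<open>Membership of a commutator becomes an equation of cosets, in which \<open>f\<close> and
  \<open>g\<close> can be replaced by better representatives.\<close>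

lemma (in normal) commutator_mem:
  assumes "f \<in> carrier G" "g \<in> carrier G" "H #> (f \<otimes> g) = H #> (g \<otimes> f)"
  shows "f \<otimes> g \<otimes> inv f \<otimes> inv g \<in> H"
proof -
  have "f \<otimes> g \<in> H #> (g \<otimes> f)"
    using rcos_self[of "f \<otimes> g" H] assms is_subgroup by simp
  then obtain h where h: "h \<in> H" "f \<otimes> g = h \<otimes> (g \<otimes> f)" unfolding r_coset_def by blast
  moreover have hG: "h \<in> carrier G" using h(1) by (rule mem_carrier)
  have "f \<otimes> g \<otimes> inv f \<otimes> inv g = h"
    unfolding h(2) using assms(1,2) hG by (simp add: m_assoc)
  with h(1) show ?thesis by simp
qed

lemma (in normal) coset_mult_left:
  assumes "t \<in> H" "x \<in> carrier G"
  shows "H #> (t \<otimes> x) = H #> x"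
  using assms coset_mult_assoc[of H t x] coset_join2[of t H] is_subgroup subset by (simp add: mem_carrier)

lemma (in normal) coset_mult_right:
  assumes "t \<in> H" "x \<in> carrier G"
  shows "H #> (x \<otimes> t) = H #> x"
proof -
  have "x \<otimes> t = (x \<otimes> t \<otimes> inv x) \<otimes> x"
    using assms by (simp add: m_assoc mem_carrier)
  then show ?thesis using coset_mult_left[OF inv_op_closed2[OF assms(2,1)] assms(2)] by simp
qed

subsection \<open>The group of rectangle exchanges\<close>

locale rectangle_exchange =
  fixes M :: "(real^'n) set"
  assumes multirectangle_M: "multirectangle M"
begin

lemma RecD:
  assumes "f \<in> Rec M"
  shows "bij_betw f M M" "x \<notin> M \<Longrightarrow> f x = x" "piecewise_translation M f"
  using assms by (simp_all add: Rec_iff[OF multirectangle_M])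

lemma Rec_bij:
  assumes "f \<in> Rec M"
  shows "bij f"
proof -
  have "bij_betw f (- M) (- M)"
    by (rule bij_betw_cong[THEN iffD2, OF _ bij_betw_id]) (simp add: RecD(2)[OF assms])
  then have "bij_betw f (M \<union> - M) (M \<union> - M)"
    by (intro bij_betw_combine RecD(1)[OF assms]) auto
  then show ?thesis by simp
qed

lemma Rec_mem_iff: "f \<in> Rec M \<Longrightarrow> f x \<in> M \<longleftrightarrow> x \<in> M"
  by (metis RecD(1,2) bij_betwE)

lemma Rec_id: "id \<in> Rec M"
  by (simp add: Rec_iff[OF multirectangle_M] piecewise_translation_id multirectangle_M)

lemma Rec_comp:
  assumes "f \<in> Rec M" "g \<in> Rec M"
  shows "g \<circ> f \<in> Rec M"
  unfolding Rec_iff[OF multirectangle_M]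
proof (intro conjI)
  show "bij_betw (g \<circ> f) M M"
    using RecD(1)[OF assms(1)] RecD(1)[OF assms(2)] by (rule bij_betw_trans)
  show "piecewise_translation M (g \<circ> f)"
    using RecD(1)[OF assms(1)]
    by (intro piecewise_translation_comp[OF RecD(3)[OF assms(1)] RecD(3)[OF assms(2)]])
      (simp add: bij_betw_def)
qed (simp add: RecD(2) assms)

lemma Rec_inverse:
  assumes "f \<in> Rec M"
  shows "inv_into UNIV f \<in> Rec M"
  unfolding Rec_iff[OF multirectangle_M]
proof (intro conjI allI impI)
  have inj: "inj f" using Rec_bij[OF assms] by (rule bij_is_inj)
  have img: "f ` M = M" using RecD(1)[OF assms] by (simp add: bij_betw_def)
  show "bij_betw (inv_into UNIV f) M M"
    using bij_betw_inv_into_subset[OF Rec_bij[OF assms] subset_UNIV img] .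
  show "inv_into UNIV f x = x" if "x \<notin> M" for x
    using inv_into_f_f[OF inj, of x] RecD(2)[OF assms that] by simp
  show "piecewise_translation M (inv_into UNIV f)"
    using piecewise_translation_inverse[OF RecD(3)[OF assms], of "inv_into UNIV f"]
    by (simp add: img inj)
qed

lemma RecGroup_simps [simp]:
  "carrier (RecGroup M) = Rec M" "mult (RecGroup M) = (\<circ>)" "one (RecGroup M) = id"
  by (simp_all add: RecGroup_def)

sublocale group "RecGroup M"
proof (rule groupI)
  fix f assume "f \<in> carrier (RecGroup M)"
  then show "\<exists>g\<in>carrier (RecGroup M). g \<otimes>\<^bsub>RecGroup M\<^esub> f = \<one>\<^bsub>RecGroup M\<^esub>"
    using Rec_inverse[of f] Rec_bij[of f]
    by (intro bexI[of _ "inv_into UNIV f"]) (simp_all add: bij_is_inj)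
qed (simp_all add: Rec_comp Rec_id comp_assoc)

lemma Rec_inv: "f \<in> Rec M \<Longrightarrow> inv\<^bsub>RecGroup M\<^esub> f \<in> Rec M"
  using inv_closed[of f] by simp

lemma Rec_inv_apply [simp]:
  assumes "f \<in> Rec M"
  shows "(inv\<^bsub>RecGroup M\<^esub> f) (f x) = x" "f ((inv\<^bsub>RecGroup M\<^esub> f) x) = x"
  using l_inv[of f] r_inv[of f] assms by (simp_all add: fun_eq_iff)

lemma Rec_inv_eqI:
  assumes "f \<in> Rec M" "g \<in> Rec M" "\<And>x. g (f x) = x"
  shows "inv\<^bsub>RecGroup M\<^esub> f = g"
proof (rule inv_equality)
  show "g \<otimes>\<^bsub>RecGroup M\<^esub> f = \<one>\<^bsub>RecGroup M\<^esub>"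
    using assms(3) by (simp add: fun_eq_iff)
qed (simp_all add: assms(1,2))

lemma Rec_subset:
  assumes "f \<in> Rec M" "multirectangle A" "A \<subseteq> M"
  shows "piecewise_translation A f" "multirectangle (f ` A)" "f ` A \<subseteq> M"
    "measure lebesgue (f ` A) \<le> measure lebesgue A"
proof -
  show pt: "piecewise_translation A f"
    using RecD(3)[OF assms(1)] assms(2,3) by (rule piecewise_translation_subset)
  show "multirectangle (f ` A)" using pt by (rule piecewise_translation_image)
  show "measure lebesgue (f ` A) \<le> measure lebesgue A"
    using pt by (rule measure_piecewise_translation_image_le)
  show "f ` A \<subseteq> M" using assms(3) Rec_mem_iff[OF assms(1)] by blast
qed

text \<open>An involution is its own inverse, so bijectivity comes for free and the work is confined
  to the set \<open>A\<close> of points that may move.\<close>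

lemma involution_in_Rec:
  assumes "multirectangle A" "A \<subseteq> M" "\<And>x. s (s x) = x" "\<And>x. x \<in> A \<Longrightarrow> s x \<in> A"
    "\<And>x. x \<notin> A \<Longrightarrow> s x = x" "piecewise_translation A s"
  shows "s \<in> Rec M"
  unfolding Rec_iff[OF multirectangle_M]
proof (intro conjI allI impI)
  have "s x \<in> M" if "x \<in> M" for x
    using assms(2,4,5) that by (cases "x \<in> A") auto
  then show "bij_betw s M M"
    by (intro bij_betw_byWitness[where f' = s]) (auto simp: assms(3))
  show "s x = x" if "x \<notin> M" for x using assms(2,5) that by blast
  have "piecewise_translation (A \<union> (M - A)) s"
    by (intro piecewise_translation_Un assms(6) piecewise_translation_id multirectangle_Diff
        multirectangle_M assms(1)) (simp add: assms(5))
  then show "piecewise_translation M s" using assms(2) by (simp add: Un_absorb1)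
qed

subsection \<open>Flips\<close>

text \<open>Only one side of the exchange is recorded; the other is s(X), a multirectangle in
  \<open>M\<close> because \<open>s\<close> lies in \<open>Rec M\<close>. The set \<open>X\<close>
  stays a parameter since flips are later cut along subsets of it.\<close>

definition flip :: "(real^'n) set \<Rightarrow> (real^'n \<Rightarrow> real^'n) \<Rightarrow> bool" where
  "flip X s \<longleftrightarrow> s \<in> Rec M \<and> multirectangle X \<and> X \<subseteq> M \<and> s ` X \<inter> X = {} \<and>
     (\<forall>x. s (s x) = x) \<and> (\<forall>x. x \<notin> X \<union> s ` X \<longrightarrow> s x = x)"

lemma flipD:
  assumes "flip X s"
  shows "s \<in> Rec M" "multirectangle X" "X \<subseteq> M" "s ` X \<inter> X = {}" "s (s x) = x"
    "x \<notin> X \<Longrightarrow> x \<notin> s ` X \<Longrightarrow> s x = x"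
proof -
  note f = assms[unfolded flip_def]
  note f1 = f[THEN conjunct2]
  note f2 = f1[THEN conjunct2]
  note f3 = f2[THEN conjunct2]
  note f4 = f3[THEN conjunct2]
  show "s \<in> Rec M" by (rule f[THEN conjunct1])
  show "multirectangle X" by (rule f1[THEN conjunct1])
  show "X \<subseteq> M" by (rule f2[THEN conjunct1])
  show "s ` X \<inter> X = {}" by (rule f3[THEN conjunct1])
  show "s (s x) = x" by (rule f4[THEN conjunct1, rule_format])
  show "s x = x" if "x \<notin> X" "x \<notin> s ` X"
    by (rule f4[THEN conjunct2, rule_format]) (use that in simp)
qed

text \<open>Using \<open>\<phi>\<close> on \<open>X\<close>, its inverse on the image and the
  identity elsewhere turns an embedding into an element of \<open>Rec M\<close>; the complements of
  the two sets never have to be matched.\<close>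

lemma ex_flip_extending:
  assumes \<phi>: "piecewise_translation X \<phi>" "inj_on \<phi> X" "X \<subseteq> M" "\<phi> ` X \<subseteq> M" "\<phi> ` X \<inter> X = {}"
  obtains s where "flip X s" "\<And>x. x \<in> X \<Longrightarrow> s x = \<phi> x"
proof -
  define s where "s x = (if x \<in> X then \<phi> x else if x \<in> \<phi> ` X then inv_into X \<phi> x else x)" for x
  have s1: "s x = \<phi> x" if "x \<in> X" for x using that by (simp add: s_def)
  have s2: "s (\<phi> x) = x" if "x \<in> X" for x
  proof -
    have "\<phi> x \<in> \<phi> ` X" "\<phi> x \<notin> X" using that \<phi>(5) by blast+
    then show ?thesis using that \<phi>(2) by (simp add: s_def)
  qed
  have s3: "s x = x" if "x \<notin> X" "x \<notin> \<phi> ` X" for x using that by (simp add: s_def)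
  have img: "s ` X = \<phi> ` X" using s1 by (rule image_cong[OF refl])
  have mX: "multirectangle X" using \<phi>(1) by (rule piecewise_translation_domain)
  have ss: "s (s x) = x" for x
  proof -
    consider "x \<in> X" | y where "y \<in> X" "x = \<phi> y" | "x \<notin> X" "x \<notin> \<phi> ` X" by blast
    then show ?thesis by cases (simp_all add: s1 s2 s3)
  qed
  have "s \<in> Rec M"
  proof (rule involution_in_Rec[where A = "X \<union> \<phi> ` X"])
    show "multirectangle (X \<union> \<phi> ` X)"
      by (intro multirectangle_Un mX piecewise_translation_image \<phi>(1))
    show "X \<union> \<phi> ` X \<subseteq> M" using \<phi>(3,4) by blast
    show "s x \<in> X \<union> \<phi> ` X" if "x \<in> X \<union> \<phi> ` X" for x
      using that by (auto simp: s1 s2)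
    show "s x = x" if "x \<notin> X \<union> \<phi> ` X" for x using that s3 by blast
    show "piecewise_translation (X \<union> \<phi> ` X) s"
    proof (rule piecewise_translation_Un)
      show "piecewise_translation X s"
        using \<phi>(1) by (rule piecewise_translation_cong[THEN iffD2, rotated]) (rule s1)
      show "piecewise_translation (\<phi> ` X) s"
        using \<phi>(1) by (rule piecewise_translation_inverse) (rule s2)
    qed
  qed (rule ss)
  with mX \<phi>(3,5) ss s3 have "flip X s" unfolding flip_def img by blast
  then show thesis using s1 by (rule that)
qed

lemma flip_conjugate:
  assumes "flip X s" "g \<in> Rec M"
  shows "flip (g ` X) (g \<circ> s \<circ> inv\<^bsub>RecGroup M\<^esub> g)"
proof -
  let ?c = "g \<circ> s \<circ> inv\<^bsub>RecGroup M\<^esub> g"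
  note s = flipD[OF assms(1)]
  have img: "?c ` (g ` X) = g ` (s ` X)" using assms(2) by (simp add: image_comp comp_def)
  have "?c \<in> Rec M" using assms(2) s(1) by (intro Rec_comp Rec_inv)
  moreover have "g ` (s ` X) \<inter> g ` X = {}"
    using s(4) by (simp add: image_Int[OF bij_is_inj[OF Rec_bij[OF assms(2)]], symmetric])
  moreover have "?c x = x" if x: "x \<notin> g ` X \<union> g ` (s ` X)" for x
  proof -
    have "(inv\<^bsub>RecGroup M\<^esub> g) x \<notin> X" "(inv\<^bsub>RecGroup M\<^esub> g) x \<notin> s ` X"
      using x Rec_inv_apply(2)[OF assms(2), of x] by (metis UnCI imageI)+
    then show ?thesis using assms(2) by (simp add: s(6))
  qed
  moreover have "?c (?c x) = x" for x using assms(2) by (simp add: s(5))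
  ultimately show ?thesis
    using Rec_subset(2,3)[OF assms(2) s(2,3)] unfolding flip_def img by blast
qed

text \<open>Conjugates of flips are flips, so the plain generated subgroup is already
  normal.\<close>

definition flip_group :: "(real^'n \<Rightarrow> real^'n) set" where
  "flip_group = generate (RecGroup M) {s. \<exists>X. flip X s}"

lemma flips_subset: "{s. \<exists>X. flip X s} \<subseteq> carrier (RecGroup M)"
  by (auto simp: flipD(1))

lemma flip_in_flip_group: "flip X s \<Longrightarrow> s \<in> flip_group"
  unfolding flip_group_def by (rule generate.incl) blast

sublocale flips: normal flip_group "RecGroup M"
  unfolding flip_group_def
proof (rule normal_generateI[OF flips_subset])
  fix h g assume "h \<in> {s. \<exists>X. flip X s}" "g \<in> carrier (RecGroup M)"
  then show "g \<otimes>\<^bsub>RecGroup M\<^esub> h \<otimes>\<^bsub>RecGroup M\<^esub> inv\<^bsub>RecGroup M\<^esub> g \<in> {s. \<exists>X. flip X s}"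
    using flip_conjugate[of _ h g] by auto
qed

lemma flip_group_Rec: "s \<in> flip_group \<Longrightarrow> s \<in> Rec M"
  using flips.mem_carrier by simp

text \<open>A small piece Q with g(Q) in the wrong place is put back by two flips,
  the first one parking g(Q) inside U and off itself.\<close>

lemma ex_flips_fixing:
  assumes g: "g \<in> Rec M" and U: "multirectangle U" "U \<subseteq> M" and Q: "multirectangle Q" "Q \<subseteq> M" "Q \<inter> U = {}"
    and small: "2 * measure lebesgue Q < measure lebesgue U"
    and fixed: "\<And>x. x \<in> F \<Longrightarrow> g x = x" "F \<inter> U = {}" "F \<inter> Q = {}"
  obtains t where "t \<in> flip_group" "\<And>x. x \<in> F \<union> Q \<Longrightarrow> t (g x) = x"
proof -
  have inj: "inj g" using Rec_bij[OF g] by (rule bij_is_inj)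
  have mgQ: "multirectangle (g ` Q)" and gQM: "g ` Q \<subseteq> M" using Rec_subset[OF g Q(1,2)] by simp_all
  \<comment> \<open>The factor 2: removing g(Q) from \<open>U\<close> costs at most the volume of
    \<open>Q\<close>, and the remainder must still exceed that volume.\<close>
  have "measure lebesgue Q < measure lebesgue (U - g ` Q)"
    using multirectangle_measure_Diff_ge[OF U(1) mgQ] Rec_subset(4)[OF g Q(1,2)] small by linarith
  then obtain \<psi> where \<psi>: "piecewise_translation Q \<psi>" "inj_on \<psi> Q" "\<psi> ` Q \<subseteq> U - g ` Q"
    using piecewise_translation_embedding[OF Q(1) multirectangle_Diff[OF U(1) mgQ]] by blast
  let ?h = "inv\<^bsub>RecGroup M\<^esub> g"
  have img1: "(\<psi> \<circ> ?h) ` (g ` Q) = \<psi> ` Q" using g by (simp add: image_comp comp_def)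
  obtain s1 where s1: "flip (g ` Q) s1" "\<And>x. x \<in> g ` Q \<Longrightarrow> s1 x = (\<psi> \<circ> ?h) x"
  proof (rule ex_flip_extending[of "g ` Q" "\<psi> \<circ> ?h"])
    show "piecewise_translation (g ` Q) (\<psi> \<circ> ?h)"
    proof (rule piecewise_translation_comp[OF _ \<psi>(1)])
      show "piecewise_translation (g ` Q) ?h"
        by (rule Rec_subset(1)[OF Rec_inv[OF g] mgQ gQM])
      show "?h ` (g ` Q) \<subseteq> Q" using g by auto
    qed
    show "inj_on (\<psi> \<circ> ?h) (g ` Q)"
      using \<psi>(2) g by (auto simp: inj_on_def)
  qed (use gQM \<psi>(3) U(2) in \<open>unfold img1, auto\<close>)
  define \<psi>' where "\<psi>' = inv_into Q \<psi>"
  have \<psi>': "\<psi>' (\<psi> x) = x" if "x \<in> Q" for x using that \<psi>(2) by (simp add: \<psi>'_def)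
  have img2: "\<psi>' ` (\<psi> ` Q) = Q" using \<psi>' by (auto simp: image_comp)
  obtain s2 where s2: "flip (\<psi> ` Q) s2" "\<And>x. x \<in> \<psi> ` Q \<Longrightarrow> s2 x = \<psi>' x"
  proof (rule ex_flip_extending[of "\<psi> ` Q" \<psi>'])
    show "piecewise_translation (\<psi> ` Q) \<psi>'"
      using \<psi>(1) by (rule piecewise_translation_inverse) (rule \<psi>')
    show "inj_on \<psi>' (\<psi> ` Q)" using \<psi>' by (auto simp: inj_on_def)
  qed (use Q(2,3) \<psi>(3) U(2) in \<open>unfold img2, auto\<close>)
  have img1': "s1 ` (g ` Q) = \<psi> ` Q"
    unfolding img1[symmetric] by (rule image_cong[OF refl]) (rule s1(2))
  have "s2 ` (\<psi> ` Q) = \<psi>' ` (\<psi> ` Q)" by (rule image_cong[OF refl]) (rule s2(2))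
  then have img2': "s2 ` (\<psi> ` Q) = Q" using img2 by (rule trans)
  show thesis
  proof (rule that)
    show "s2 \<circ> s1 \<in> flip_group"
      using flips.m_closed[OF flip_in_flip_group[OF s2(1)] flip_in_flip_group[OF s1(1)]] by simp
    fix x assume "x \<in> F \<union> Q"
    then show "(s2 \<circ> s1) (g x) = x"
    proof
      \<comment> \<open>No earlier repair is undone: the two flips move only points of g(Q),
        \<open>Q\<close> and \<open>U\<close>. The fixed set \<open>F\<close> misses
        \<open>Q\<close> and \<open>U\<close>, and it misses g(Q) because \<open>g\<close> is
        injective and fixes \<open>F\<close>.\<close>
      assume x: "x \<in> F"
      then have "x \<notin> U" "x \<notin> Q" using fixed(2,3) by blast+
      moreover have "x \<notin> g ` Q" using x fixed(1) inj \<open>x \<notin> Q\<close> by (metis imageE injD)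
      ultimately have "s1 x = x" "s2 x = x"
        using flipD(6)[OF s1(1), of x] flipD(6)[OF s2(1), of x] \<psi>(3) unfolding img1' img2' by blast+
      then show ?thesis using fixed(1)[OF x] by simp
    next
      assume "x \<in> Q"
      then show ?thesis using s1(2)[of "g x"] s2(2)[of "\<psi> x"] \<psi>' g by simp
    qed
  qed
qed

text \<open>Each repair may use all of \<open>U\<close> again as parking space, since nothing is
  claimed about points of \<open>U\<close>. Hence only the size of a single piece matters, not the
  total volume of the pieces.\<close>

lemma ex_flips_supported:
  assumes f: "f \<in> Rec M" and U: "multirectangle U" "U \<subseteq> M" "U \<noteq> {}"
  obtains t where "t \<in> flip_group" "\<And>x. x \<notin> U \<Longrightarrow> t (f x) = x"
proof -
  \<comment> \<open>Half, to meet the volume requirement of \<open>ex_flips_fixing\<close> on each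
    piece.\<close>
  have "0 < measure lebesgue U / 2" using multirectangle_measure_pos[OF U(1,3)] by simp
  from multirectangle_small_partition[OF multirectangle_Diff[OF multirectangle_M U(1)] this]
  obtain P where P: "finite P" "\<And>R. R \<in> P \<Longrightarrow> rectangle R"
    "\<And>R. R \<in> P \<Longrightarrow> measure lebesgue R < measure lebesgue U / 2" "disjoint P" "\<Union>P = M - U"
    by blast
  have "\<exists>t\<in>flip_group. \<forall>x\<in>\<Union>K. t (f x) = x" if "finite K" "K \<subseteq> P" for K
    using that
  proof (induction K rule: finite_induct)
    case empty
    then show ?case using flips.one_closed by auto
  next
    case (insert Q K)
    then obtain t where t: "t \<in> flip_group" "\<And>x. x \<in> \<Union>K \<Longrightarrow> t (f x) = x" by auto
    have Q: "Q \<in> P" "K \<subseteq> P" using insert.prems by auto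
    then have sub: "Q \<subseteq> M - U" "\<Union>K \<subseteq> M - U" using P(5) by blast+
    have "S \<inter> Q = {}" if "S \<in> K" for S
      by (rule disjointD[OF P(4)]) (use Q that insert.hyps(2) in auto)
    then have disj: "\<Union>K \<inter> Q = {}" by blast
    have QU: "Q \<subseteq> M" "Q \<inter> U = {}" "\<Union>K \<inter> U = {}" using sub by auto
    have tfR: "t \<circ> f \<in> Rec M" using f flip_group_Rec[OF t(1)] by (rule Rec_comp)
    have tf: "(t \<circ> f) x = x" if "x \<in> \<Union>K" for x using t(2)[OF that] by simp
    have mQ: "multirectangle Q" using P(2)[OF Q(1)] by (rule multirectangle_rectangle)
    have small: "2 * measure lebesgue Q < measure lebesgue U" using P(3)[OF Q(1)] by simp
    obtain t' where t': "t' \<in> flip_group" "\<And>x. x \<in> \<Union>K \<union> Q \<Longrightarrow> t' ((t \<circ> f) x) = x"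
      using ex_flips_fixing[OF tfR U(1,2) mQ QU(1,2) small tf QU(3) disj] by metis
    have "t' \<circ> t \<in> flip_group" using flips.m_closed[OF t'(1) t(1)] by simp
    moreover have "\<forall>x\<in>\<Union>(insert Q K). (t' \<circ> t) (f x) = x" using t'(2) by auto
    ultimately show ?case by blast
  qed
  from this[OF P(1) subset_refl] obtain t where t: "t \<in> flip_group" "\<forall>x\<in>M - U. t (f x) = x"
    unfolding P(5) by blast
  show thesis
  proof (rule that[OF t(1)])
    fix x assume "x \<notin> U"
    then show "t (f x) = x"
      using t RecD(2)[OF f, of x] RecD(2)[OF flip_group_Rec[OF t(1)], of x] by (cases "x \<in> M") auto
  qed
qed

lemma ex_nonempty_flip:
  assumes "M \<noteq> {}"
  obtains U s where "multirectangle U" "U \<subseteq> M" "U \<noteq> {}" "flip U s"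
proof -
  obtain x where "x \<in> M" using assms by blast
  then obtain R where R: "rectangle R" "R \<subseteq> M" "x \<in> R"
    using multirectangle_contains_rectangle[OF multirectangle_M] by metis
  obtain U v where U: "rectangle U" "(+) v ` U \<inter> U = {}" "U \<union> (+) v ` U = R"
    using R(1) by (rule rectangle_halves)
  have mU: "multirectangle U" using U(1) by (rule multirectangle_rectangle)
  obtain s where "flip U s"
  proof (rule ex_flip_extending[of U "(+) v"])
    show "piecewise_translation U ((+) v)"
      by (rule piecewise_translationI[where I = "{v}" and A = "\<lambda>_. U" and v = id])
        (auto simp: mU)
  qed (use U(2,3) R(2) in auto)
  moreover have "U \<noteq> {}" using U(3) R(3) by auto
  ultimately show thesis using that mU U(3) R(2) by blast
qed

lemma derived_subset_flip_group:
  assumes "M \<noteq> {}"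
  shows "derived (RecGroup M) (Rec M) \<subseteq> flip_group"
proof -
  obtain U s where U: "multirectangle U" "U \<subseteq> M" "U \<noteq> {}" and s: "flip U s"
    using assms by (rule ex_nonempty_flip)
  have sT: "s \<in> flip_group" using s by (rule flip_in_flip_group)
  have comm: "flip_group #>\<^bsub>RecGroup M\<^esub> (f \<circ> g) = flip_group #>\<^bsub>RecGroup M\<^esub> (g \<circ> f)"
    if f: "f \<in> Rec M" and g: "g \<in> Rec M" for f g
  proof -
    obtain t where t: "t \<in> flip_group" "\<And>x. x \<notin> U \<Longrightarrow> t (f x) = x"
      using ex_flips_supported[OF f U] by metis
    obtain u where u: "u \<in> flip_group" "\<And>x. x \<notin> U \<Longrightarrow> u (g x) = x"
      using ex_flips_supported[OF g U] by metis
    \<comment> \<open>Corrected by flips, \<open>f\<close> and \<open>g\<close> are both supported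
      in \<open>U\<close>. Conjugation by the involution \<open>s\<close> then moves the second
      support to s(U), without changing the coset because \<open>s\<close> is itself a flip.\<close>
    define f' where "f' = t \<circ> f"
    define g' where "g' = s \<circ> (u \<circ> g \<circ> s)"
    have f'R: "f' \<in> Rec M" unfolding f'_def by (intro Rec_comp f flip_group_Rec t)
    have ugR: "u \<circ> g \<in> Rec M" by (intro Rec_comp g flip_group_Rec u)
    have ugsR: "u \<circ> g \<circ> s \<in> Rec M" by (intro Rec_comp ugR flip_group_Rec sT)
    have g'R: "g' \<in> Rec M" unfolding g'_def by (intro Rec_comp ugsR flip_group_Rec sT)
    have cf: "flip_group #>\<^bsub>RecGroup M\<^esub> f' = flip_group #>\<^bsub>RecGroup M\<^esub> f"
      using flips.coset_mult_left[OF t(1), of f] f by (simp add: f'_def)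
    have cg: "flip_group #>\<^bsub>RecGroup M\<^esub> g' = flip_group #>\<^bsub>RecGroup M\<^esub> g"
      using flips.coset_mult_left[OF sT, of "u \<circ> g \<circ> s"] flips.coset_mult_right[OF sT, of "u \<circ> g"]
        flips.coset_mult_left[OF u(1), of g] g ugR ugsR by (simp add: g'_def)
    have "f' \<circ> g' = g' \<circ> f'"
    proof (rule disjoint_supports_commute[where A = U and B = "s ` U"])
      show "inj f'" "inj g'" using f'R g'R by (simp_all add: Rec_bij bij_is_inj)
      show "f' x = x" if "x \<notin> U" for x using t(2) that by (simp add: f'_def)
      show "g' x = x" if "x \<notin> s ` U" for x
      proof -
        have "s x \<notin> U" using that flipD(5)[OF s, of x] by (metis imageI)
        then show ?thesis using u(2) flipD(5)[OF s] by (simp add: g'_def)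
      qed
      show "U \<inter> s ` U = {}" using flipD(4)[OF s] by blast
    qed
    then show ?thesis
      using flips.rcos_sum[of f g] flips.rcos_sum[of g f] flips.rcos_sum[of f' g'] flips.rcos_sum[of g' f']
        f g f'R g'R by (simp add: cf cg)
  qed
  have "derived_set (RecGroup M) (Rec M) \<subseteq> flip_group"
  proof
    fix h assume "h \<in> derived_set (RecGroup M) (Rec M)"
    then obtain f g where fg: "f \<in> Rec M" "g \<in> Rec M" "h = f \<otimes>\<^bsub>RecGroup M\<^esub> g \<otimes>\<^bsub>RecGroup M\<^esub> inv\<^bsub>RecGroup M\<^esub> f \<otimes>\<^bsub>RecGroup M\<^esub> inv\<^bsub>RecGroup M\<^esub> g"
      by blast
    show "h \<in> flip_group" unfolding fg(3)
      by (rule flips.commutator_mem) (use fg(1,2) comm in simp_all)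
  qed
  then show ?thesis
    unfolding derived_def by (rule generate_subgroup_incl) (rule flips.is_subgroup)
qed

section \<open>Cutting flips along partitions\<close>

definition flip_restrict :: "(real^'n \<Rightarrow> real^'n) \<Rightarrow> (real^'n) set \<Rightarrow> real^'n \<Rightarrow> real^'n" where
  "flip_restrict s Y x = (if x \<in> Y \<union> s ` Y then s x else x)"

text \<open>The set Y \<union> s(Y) is invariant under the involution \<open>s\<close>, so cutting
  \<open>s\<close> down to it leaves an involution.\<close>

lemma flip_flip_restrict:
  assumes "flip X s" "multirectangle Y" "Y \<subseteq> X"
  shows "flip Y (flip_restrict s Y)"
proof -
  note s = flipD[OF assms(1)]
  have YM: "Y \<subseteq> M" using assms(3) s(3) by blast
  have inv: "s x \<in> Y \<union> s ` Y \<longleftrightarrow> x \<in> Y \<union> s ` Y" for x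
    using s(5) by (metis Un_iff imageE imageI)
  have img: "flip_restrict s Y ` Y = s ` Y"
    by (rule image_cong) (simp_all add: flip_restrict_def)
  have ss: "flip_restrict s Y (flip_restrict s Y x) = x" for x
  proof (cases "x \<in> Y \<union> s ` Y")
    case True
    then have "s x \<in> Y \<union> s ` Y" by (simp only: inv)
    then show ?thesis using True by (simp only: flip_restrict_def if_True s(5))
  next
    case False
    then show ?thesis by (simp only: flip_restrict_def if_False)
  qed
  have "flip_restrict s Y \<in> Rec M"
  proof (rule involution_in_Rec[where A = "Y \<union> s ` Y"])
    show m: "multirectangle (Y \<union> s ` Y)"
      by (intro multirectangle_Un assms(2) Rec_subset(2)[OF s(1)] YM)
    show sub: "Y \<union> s ` Y \<subseteq> M" using YM Rec_subset(3)[OF s(1) assms(2) YM] by blast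
    show "piecewise_translation (Y \<union> s ` Y) (flip_restrict s Y)"
      using Rec_subset(1)[OF s(1) m sub]
      by (rule piecewise_translation_cong[THEN iffD2, rotated]) (simp add: flip_restrict_def)
  qed (use ss inv in \<open>simp_all add: flip_restrict_def\<close>)
  moreover have "s ` Y \<inter> Y = {}" using s(4) assms(3) by blast
  ultimately show ?thesis
    unfolding flip_def img using assms(2) YM ss by (simp add: flip_restrict_def)
qed

lemma flip_restrict_Un:
  assumes "flip X s" "A \<union> B \<subseteq> X" "A \<inter> B = {}"
  shows "flip_restrict s (A \<union> B) = flip_restrict s A \<circ> flip_restrict s B"
proof
  fix x
  note s = flipD[OF assms(1)]
  have inv: "s x \<in> Y \<union> s ` Y \<longleftrightarrow> x \<in> Y \<union> s ` Y" for x Y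
    using s(5) by (metis Un_iff imageE imageI)
  have "(A \<union> s ` A) \<inter> (B \<union> s ` B) = {}"
  proof -
    have "s ` A \<inter> s ` B = {}"
      using assms(3) bij_is_inj[OF Rec_bij[OF s(1)]] by (simp add: image_Int[symmetric])
    moreover have "s ` A \<inter> B = {}" "A \<inter> s ` B = {}" using s(4) assms(2) by blast+
    ultimately show ?thesis using assms(3) by blast
  qed
  then show "flip_restrict s (A \<union> B) x = (flip_restrict s A \<circ> flip_restrict s B) x"
    using inv[of x B] by (auto simp: flip_restrict_def)
qed

lemma flip_restrict_self:
  assumes "flip X s"
  shows "flip_restrict s X = s"
  using flipD(6)[OF assms] by (auto simp: flip_restrict_def fun_eq_iff)

text \<open>The restrictions of a flip to the pieces of a partition of \<open>X\<close> compose to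
  the flip, so flips of rectangles below any prescribed volume already generate
  \<open>flip_group\<close>. The bound \<open>e\<close> can thus be adapted to
  \<open>K\<close>.\<close>

lemma flip_group_subset:
  assumes K: "subgroup K (RecGroup M)" and e: "0 < e"
    and small: "\<And>R s. rectangle R \<Longrightarrow> measure lebesgue R < e \<Longrightarrow> flip R s \<Longrightarrow> s \<in> K"
  shows "flip_group \<subseteq> K"
proof -
  have "s \<in> K" if s: "flip X s" for X s
  proof -
    from multirectangle_small_partition[OF flipD(2)[OF s] e]
    obtain P where P: "finite P" "\<And>R. R \<in> P \<Longrightarrow> rectangle R"
      "\<And>R. R \<in> P \<Longrightarrow> measure lebesgue R < e" "disjoint P" "\<Union>P = X"
      by blast
    have "flip_restrict s (\<Union>Q) \<in> K" if "finite Q" "Q \<subseteq> P" for Q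
      using that
    proof (induction Q rule: finite_induct)
      case empty
      have "flip_restrict s (\<Union>{}) = id" by (simp add: flip_restrict_def fun_eq_iff)
      then show ?case using subgroup.one_closed[OF K] by (simp only: RecGroup_simps)
    next
      case (insert R Q)
      have R: "R \<in> P" "Q \<subseteq> P" using insert.prems by auto
      have sub: "R \<union> \<Union>Q \<subseteq> X" using R P(5) by blast
      have "R \<inter> S = {}" if "S \<in> Q" for S
        by (rule disjointD[OF P(4)]) (use R that insert.hyps(2) in auto)
      then have disj: "R \<inter> \<Union>Q = {}" by blast
      have "flip R (flip_restrict s R)"
        using sub by (intro flip_flip_restrict[OF s] multirectangle_rectangle P(2) R) simp
      then have "flip_restrict s R \<in> K" by (rule small[OF P(2,3)[OF R(1)]])
      then have "flip_restrict s R \<circ> flip_restrict s (\<Union>Q) \<in> K"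
        using subgroup.m_closed[OF K] insert.IH[OF R(2)] by simp
      then show ?case unfolding Union_insert flip_restrict_Un[OF s sub disj] .
    qed
    from this[OF P(1) subset_refl] show ?thesis
      using P(5) flip_restrict_self[OF s] by simp
  qed
  then have "{s. \<exists>X. flip X s} \<subseteq> K" by blast
  then show ?thesis unfolding flip_group_def by (rule generate_subgroup_incl) (rule K)
qed

text \<open>With R cut into halves U and U + v, the flip s is the product of its restriction a to U
  and of the restriction to U + v, and the latter is conjugate to a by the flip b that
  exchanges U with U + v and s(U) with s(U + v).\<close>

lemma rectangle_flip_commutator:
  assumes R: "rectangle R" and s: "flip R s"
  obtains a b where "a \<in> flip_group" "b \<in> flip_group"
    "\<And>x. x \<notin> R \<union> s ` R \<Longrightarrow> a x = x" "\<And>x. x \<notin> R \<union> s ` R \<Longrightarrow> b x = x"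
    "s = a \<circ> b \<circ> inv\<^bsub>RecGroup M\<^esub> a \<circ> inv\<^bsub>RecGroup M\<^esub> b"
proof -
  obtain U v where U: "rectangle U" "(+) v ` U \<inter> U = {}" "U \<union> (+) v ` U = R"
    using R by (rule rectangle_halves)
  note sD = flipD[OF s]
  define V where "V = (+) v ` U"
  have UV: "U \<union> V = R" "U \<inter> V = {}" using U(2,3) by (auto simp: V_def)
  have mU: "multirectangle U" using U(1) by (rule multirectangle_rectangle)
  have mV: "multirectangle V" unfolding V_def using mU by (rule multirectangle_translation)
  have UM: "U \<subseteq> M" "V \<subseteq> M" using UV sD(3) by blast+
  have inj: "inj s" using Rec_bij[OF sD(1)] by (rule bij_is_inj)
  have disj: "s ` U \<inter> U = {}" "s ` U \<inter> V = {}" "s ` V \<inter> U = {}" "s ` V \<inter> V = {}" "s ` U \<inter> s ` V = {}"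
    using sD(4) UV(1) image_Int[OF inj, of U V] UV(2) by (blast, blast, blast, blast, simp)
  define a where "a = flip_restrict s U"
  define c where "c = flip_restrict s V"
  have flip_a: "flip U a" unfolding a_def using UV by (intro flip_flip_restrict[OF s] mU) auto
  \<comment> \<open>Meant for points of U and s(U). On s(U) it is the translation by
    \<open>v\<close> conjugated by \<open>s\<close>, which makes \<open>b\<close> commute with
    \<open>s\<close> on the sets that it exchanges.\<close>
  define \<phi> where "\<phi> x = (if x \<in> U then x + v else s (s x + v))" for x
  have \<phi>1: "\<phi> x = v + x" if "x \<in> U" for x using that by (simp add: \<phi>_def add.commute)
  have \<phi>2: "\<phi> (s x) = s (v + x)" if "x \<in> U" for x
    using that disj(1) sD(5) by (auto simp: \<phi>_def add.commute)
  have img\<phi>: "\<phi> ` (U \<union> s ` U) = V \<union> s ` V"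
  proof -
    have "\<phi> ` U = V" unfolding V_def by (rule image_cong[OF refl]) (rule \<phi>1)
    moreover have "\<phi> ` (s ` U) = s ` V"
      unfolding V_def image_image by (rule image_cong[OF refl]) (rule \<phi>2)
    ultimately show ?thesis by (simp add: image_Un)
  qed
  obtain b where b: "flip (U \<union> s ` U) b" "\<And>x. x \<in> U \<union> s ` U \<Longrightarrow> b x = \<phi> x"
  proof (rule ex_flip_extending[of "U \<union> s ` U" \<phi>])
    have tr: "piecewise_translation U ((+) v)"
      by (rule piecewise_translationI[where I = "{v}" and A = "\<lambda>_. U" and v = id]) (auto simp: mU)
    have "piecewise_translation (s ` U) ((s \<circ> (+) v) \<circ> s)"
    proof (intro piecewise_translation_comp)
      show "piecewise_translation (s ` U) s"
        by (intro Rec_subset(1)[OF sD(1)] Rec_subset(2,3)[OF sD(1) mU] UM)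
      show "piecewise_translation U ((+) v)" by (rule tr)
      show "piecewise_translation V s" by (intro Rec_subset(1)[OF sD(1)] mV UM)
      show "(+) v ` U \<subseteq> V" by (simp add: V_def)
      show "s ` (s ` U) \<subseteq> U" using sD(5) by auto
    qed
    then have "piecewise_translation (s ` U) \<phi>"
      by (rule piecewise_translation_cong[THEN iffD2, rotated]) (auto simp: \<phi>2 sD(5))
    moreover have "piecewise_translation U \<phi>"
      using tr by (rule piecewise_translation_cong[THEN iffD2, rotated]) (rule \<phi>1)
    ultimately show "piecewise_translation (U \<union> s ` U) \<phi>" by (rule piecewise_translation_Un[rotated])
    show "inj_on \<phi> (U \<union> s ` U)"
    proof -
      have "inj_on \<phi> U" using \<phi>1 by (auto simp: inj_on_def)
      moreover have "inj_on \<phi> (s ` U)"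
      proof (rule inj_onI)
        fix p q assume "p \<in> s ` U" "q \<in> s ` U" and eq: "\<phi> p = \<phi> q"
        then obtain x y where xy: "x \<in> U" "p = s x" "y \<in> U" "q = s y" by blast
        with eq have "s (v + x) = s (v + y)" by (simp add: \<phi>2)
        then have "v + x = v + y" by (rule injD[OF inj])
        then show "p = q" by (simp add: xy)
      qed
      moreover have "\<phi> ` (U - s ` U) \<inter> \<phi> ` (s ` U - U) = {}"
      proof -
        have "\<phi> ` U \<subseteq> V" using \<phi>1 by (auto simp: V_def)
        moreover have "\<phi> ` (s ` U) \<subseteq> s ` V" using \<phi>2 by (auto simp: V_def)
        ultimately show ?thesis using disj(4) by blast
      qed
      ultimately show ?thesis by (simp add: inj_on_Un)
    qed
    show "U \<union> s ` U \<subseteq> M" using UM Rec_subset(3)[OF sD(1) mU UM(1)] by blast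
    show "\<phi> ` (U \<union> s ` U) \<subseteq> M" unfolding img\<phi> using UM Rec_subset(3)[OF sD(1) mV UM(2)] by blast
    show "\<phi> ` (U \<union> s ` U) \<inter> (U \<union> s ` U) = {}" unfolding img\<phi> using disj UV(2) by blast
  qed (rule that)
  have imgb: "b ` (U \<union> s ` U) = V \<union> s ` V"
    unfolding img\<phi>[symmetric] by (rule image_cong[OF refl]) (rule b(2))
  note aD = flipD[OF flip_a] and bD = flipD[OF b(1)]
  have inva: "inv\<^bsub>RecGroup M\<^esub> a = a" and invb: "inv\<^bsub>RecGroup M\<^esub> b = b"
    by (rule Rec_inv_eqI[OF aD(1,1,5)], rule Rec_inv_eqI[OF bD(1,1,5)])
  have b_s: "b (s x) = s (b x)" if xV: "x \<in> V \<union> s ` V" for x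
  proof -
    have 1: "b (s y) = s (b y)" if "y \<in> U" for y
      using that b(2) \<phi>1 \<phi>2 by simp
    have "b (s (b y)) = s (b (b y))" if yU: "y \<in> U \<union> s ` U" for y
    proof (cases "y \<in> U")
      case True
      then show ?thesis using 1[of y] bD(5) by metis
    next
      case False
      then obtain z where "z \<in> U" "y = s z" using yU by blast
      then show ?thesis using 1[of z] bD(5) sD(5) by metis
    qed
    moreover obtain y where "y \<in> U \<union> s ` U" "x = b y" using xV unfolding imgb[symmetric] by blast
    ultimately show ?thesis by simp
  qed
  \<comment> \<open>Since \<open>b\<close> exchanges U \<union> s(U) with V \<union> s(V) and
    commutes with \<open>s\<close> there, it conjugates one restriction of \<open>s\<close> into the
    other.\<close>
  have conj: "b \<circ> a \<circ> b = c"
  proof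
    fix x
    show "(b \<circ> a \<circ> b) x = c x"
    proof (cases "x \<in> V \<union> s ` V")
      case True
      then obtain y where y: "y \<in> U \<union> s ` U" "x = b y" unfolding imgb[symmetric] by blast
      then have "b x \<in> U \<union> s ` U" using bD(5) by simp
      then show ?thesis using True b_s[OF True, symmetric] bD(5)
        by (simp add: a_def c_def flip_restrict_def) 
    next
      case False
      then have "b x \<notin> U \<union> s ` U" using imgb bD(5) by (metis imageI)
      then show ?thesis using False bD(5) by (simp add: a_def c_def flip_restrict_def)
    qed
  qed
  have "s = flip_restrict s (U \<union> V)" using flip_restrict_self[OF s] UV(1) by simp
  also have "\<dots> = a \<circ> c" unfolding a_def c_def by (rule flip_restrict_Un[OF s]) (use UV in auto)
  \<comment> \<open>As \<open>a\<close> and \<open>b\<close> are involutions, this word is their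
    commutator.\<close>
  also have "\<dots> = a \<circ> b \<circ> a \<circ> b" unfolding conj[symmetric] by (simp add: comp_assoc)
  finally have s_eq: "s = a \<circ> b \<circ> inv\<^bsub>RecGroup M\<^esub> a \<circ> inv\<^bsub>RecGroup M\<^esub> b"
    unfolding inva invb .
  show thesis
  proof (rule that[OF _ _ _ _ s_eq])
    show "a \<in> flip_group" "b \<in> flip_group"
      using flip_a b(1) by (auto intro: flip_in_flip_group)
    fix x assume x: "x \<notin> R \<union> s ` R"
    then show "a x = x" using UV(1) by (auto simp: a_def flip_restrict_def)
    have "x \<notin> U \<union> s ` U" "x \<notin> b ` (U \<union> s ` U)" unfolding imgb using x UV(1) by blast+
    then show "b x = x" by (rule bD(6))
  qed
qed

lemma commutator_in_derived:
  "a \<in> Rec M \<Longrightarrow> b \<in> Rec M \<Longrightarrow>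
    a \<circ> b \<circ> inv\<^bsub>RecGroup M\<^esub> a \<circ> inv\<^bsub>RecGroup M\<^esub> b \<in> derived (RecGroup M) (Rec M)"
  unfolding derived_def by (rule generate.incl) (auto simp: RecGroup_def)

lemma derived_subgroup: "subgroup (derived (RecGroup M) (Rec M)) (RecGroup M)"
  using derived_is_subgroup[of "Rec M"] by simp

lemma flip_group_subset_derived: "flip_group \<subseteq> derived (RecGroup M) (Rec M)"
\<comment> \<open>The bound 1 is arbitrary: rectangle flips of every size are commutators.\<close>
proof (rule flip_group_subset[OF derived_subgroup, of 1])
  fix R s assume "rectangle R" "flip R s"
  then obtain a b where "a \<in> flip_group" "b \<in> flip_group"
    "s = a \<circ> b \<circ> inv\<^bsub>RecGroup M\<^esub> a \<circ> inv\<^bsub>RecGroup M\<^esub> b"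
    using rectangle_flip_commutator by metis
  then show "s \<in> derived (RecGroup M) (Rec M)"
    using commutator_in_derived flip_group_Rec by simp
qed simp

subsection \<open>Subgroups normalized by the derived subgroup\<close>

text \<open>On a level set \<open>f\<close> is a translation by a vector with some nonzero
  coordinate \<open>k\<close>. A slab across that coordinate, thinner than the displacement, is
  moved off itself, and so is the part of a rectangle of the level set inside it.\<close>

lemma ex_displaced_multirectangle:
  assumes f: "f \<in> Rec M" "f \<noteq> id"
  obtains R where "multirectangle R" "R \<noteq> {}" "R \<subseteq> M" "f ` R \<inter> R = {}"
proof -
  obtain x where x: "f x \<noteq> x" using f(2) by (auto simp: fun_eq_iff)
  then have xM: "x \<in> M" using RecD(2)[OF f(1)] by blast
  define v where "v = f x - x"
  have "multirectangle {y\<in>M. f y - y = v}"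
    using RecD(3)[OF f(1)] by (simp add: piecewise_translation_def)
  moreover have "x \<in> {y\<in>M. f y - y = v}" by (simp add: xM v_def)
  ultimately obtain S where S: "rectangle S" "x \<in> S" "S \<subseteq> {y\<in>M. f y - y = v}"
    by (rule multirectangle_contains_rectangle)
  have "v \<noteq> 0" using x by (simp add: v_def)
  then obtain k where k: "v$k \<noteq> 0" by (auto simp: vec_eq_iff)
  \<comment> \<open>Half of the displacement is a safe thickness; the slab starts at
    \<open>x\<close>, so the piece cut out contains \<open>x\<close>.\<close>
  define I where "I = {y. y$k < x$k + \<bar>v$k\<bar> / 2} \<inter> {y. x$k \<le> y$k}"
  have 1: "x \<in> S \<inter> {y. y$k < x$k + \<bar>v$k\<bar> / 2}" using S(2) k by simp
  then have "rectangle (S \<inter> {y. y$k < x$k + \<bar>v$k\<bar> / 2})" by (intro rectangle_Int_less S) blast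
  note ge = rectangle_Int_ge[OF this, of "x$k" k]
  have xI: "x \<in> S \<inter> I" using 1 by (simp add: I_def)
  then have "rectangle (S \<inter> I)"
    unfolding I_def Int_assoc[symmetric] by (intro ge) blast
  moreover note xI
  moreover have "f ` (S \<inter> I) \<inter> (S \<inter> I) = {}"
  proof -
    have "f y \<notin> I" if y: "y \<in> S \<inter> I" for y
    proof
      assume "f y \<in> I"
      moreover have "f y - y = v" using y S(3) by blast
      then have "f y $ k = y$k + v$k" by (metis add.commute diff_add_cancel vector_add_component)
      ultimately show False using y k by (auto simp: I_def)
    qed
    then show ?thesis by blast
  qed
  moreover have "S \<inter> I \<subseteq> M" using S(3) by blast
  ultimately show thesis by (intro that[of "S \<inter> I"] multirectangle_rectangle) auto
qed

text \<open>Since f displaces R, the commutator p of a and f differs from a only by an element supported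
  in f(R), hence commuting with b; so p and b have the same commutator as a and b.\<close>

lemma commutator_in_normalized:
  assumes H: "subgroup H (RecGroup M)"
    and norm: "\<And>g h. g \<in> derived (RecGroup M) (Rec M) \<Longrightarrow> h \<in> H \<Longrightarrow> g \<circ> h \<circ> inv\<^bsub>RecGroup M\<^esub> g \<in> H"
    and f: "f \<in> H" "f ` R \<inter> R = {}"
    and a: "a \<in> derived (RecGroup M) (Rec M)" "\<And>x. x \<notin> R \<Longrightarrow> a x = x"
    and b: "b \<in> derived (RecGroup M) (Rec M)" "\<And>x. x \<notin> R \<Longrightarrow> b x = x"
  shows "a \<circ> b \<circ> inv\<^bsub>RecGroup M\<^esub> a \<circ> inv\<^bsub>RecGroup M\<^esub> b \<in> H"
proof -
  let ?i = "m_inv (RecGroup M)"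
  have fR: "f \<in> Rec M" and aR: "a \<in> Rec M" and bR: "b \<in> Rec M"
    using f(1) a(1) b(1) subgroup.mem_carrier[OF H] subgroup.mem_carrier[OF derived_subgroup] by simp_all
  define q where "q = f \<circ> ?i a \<circ> ?i f"
  have qR: "q \<in> Rec M" unfolding q_def by (intro Rec_comp Rec_inv fR aR)
  define p where "p = a \<circ> q"
  have pR: "p \<in> Rec M" unfolding p_def by (intro Rec_comp qR aR)
  \<comment> \<open>In this grouping \<open>p\<close> is visibly in \<open>H\<close>: the first
    factor conjugates \<open>f\<close> by an element of the derived subgroup.\<close>
  have "p = (a \<circ> f \<circ> ?i a) \<circ> ?i f" by (simp add: p_def q_def comp_assoc)
  then have pH: "p \<in> H"
    using subgroup.m_closed[OF H norm[OF a(1) f(1)] subgroup.m_inv_closed[OF H f(1)]] by simp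
  then have "p \<circ> (b \<circ> ?i p \<circ> ?i b) \<in> H"
    using subgroup.m_closed[OF H pH norm[OF b(1) subgroup.m_inv_closed[OF H pH]]] by simp
  moreover have "p \<circ> (b \<circ> ?i p \<circ> ?i b) = a \<circ> b \<circ> ?i a \<circ> ?i b"
  proof -
    have "q \<circ> b = b \<circ> q"
    proof (rule disjoint_supports_commute[where A = "f ` R" and B = R])
      show "inj q" "inj b" using qR bR by (simp_all add: Rec_bij bij_is_inj)
      show "q x = x" if "x \<notin> f ` R" for x
      proof -
        have "?i f x \<notin> R" using that Rec_inv_apply(2)[OF fR, of x] by (metis imageI)
        then have "a (?i f x) = ?i f x" by (rule a(2))
        then have "?i a (?i f x) = ?i f x" using Rec_inv_apply(1)[OF aR] by metis
        then show ?thesis using fR by (simp add: q_def)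
      qed
    qed (use b(2) f(2) in auto)
    then have pb: "p \<circ> b = a \<circ> b \<circ> q" by (simp only: p_def comp_assoc)
    have qp: "q \<circ> ?i p = ?i a"
    proof
      fix x
      have p: "a (q z) = p z" for z by (simp add: p_def)
      have "?i a (a (q (?i p x))) = q (?i p x)" by (rule Rec_inv_apply(1)[OF aR])
      then show "(q \<circ> ?i p) x = ?i a x" by (simp only: p Rec_inv_apply(2)[OF pR] comp_apply)
    qed
    have "p \<circ> (b \<circ> ?i p \<circ> ?i b) = (p \<circ> b) \<circ> ?i p \<circ> ?i b" by (simp only: comp_assoc)
    also have "\<dots> = a \<circ> b \<circ> (q \<circ> ?i p) \<circ> ?i b" by (simp only: pb comp_assoc)
    finally show ?thesis unfolding qp .
  qed
  ultimately show ?thesis by (simp only:)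
qed

text \<open>A small flip \<open>s\<close> is a commutator of two members of
  \<open>flip_group\<close> supported in X \<union> s(X). A flip \<open>c\<close> carries this
  support into a set displaced by \<open>f\<close>, where commutators of elements of the derived
  subgroup lie in \<open>H\<close>. Conjugating back by \<open>c\<close> stays in \<open>H\<close>,
  because \<open>c\<close> itself lies in the derived subgroup.\<close>

lemma flip_group_subset_normalized:
  assumes H: "subgroup H (RecGroup M)" "H \<noteq> {id}"
    and norm: "\<And>g h. g \<in> derived (RecGroup M) (Rec M) \<Longrightarrow> h \<in> H \<Longrightarrow> g \<circ> h \<circ> inv\<^bsub>RecGroup M\<^esub> g \<in> H"
  shows "flip_group \<subseteq> H"
proof -
  let ?i = "m_inv (RecGroup M)"
  have "id \<in> H" using subgroup.one_closed[OF H(1)] by simp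
  then obtain f where f: "f \<in> H" "f \<noteq> id" using H(2) by blast
  have "f \<in> Rec M" using f(1) subgroup.mem_carrier[OF H(1)] by simp
  then obtain R where R: "multirectangle R" "R \<noteq> {}" "R \<subseteq> M" "f ` R \<inter> R = {}"
    using f(2) by (rule ex_displaced_multirectangle)
  show ?thesis
  proof (rule flip_group_subset[OF H(1)])
    \<comment> \<open>The quarter: \<open>Z\<close> below has at most twice the volume of
      \<open>X\<close>, and embedding it into \<open>R - Z\<close> is possible once twice its volume
      is below that of \<open>R\<close>.\<close>
    show "0 < measure lebesgue R / 4" using multirectangle_measure_pos[OF R(1,2)] by simp
    fix X s assume X: "rectangle X" "measure lebesgue X < measure lebesgue R / 4" and s: "flip X s"
    obtain a b where a: "a \<in> flip_group" "\<And>x. x \<notin> X \<union> s ` X \<Longrightarrow> a x = x"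
      and b: "b \<in> flip_group" "\<And>x. x \<notin> X \<union> s ` X \<Longrightarrow> b x = x"
      and s_eq: "s = a \<circ> b \<circ> ?i a \<circ> ?i b"
      using rectangle_flip_commutator[OF X(1) s] by metis
    define Z where "Z = X \<union> s ` X"
    note sD = flipD[OF s]
    have mZ: "multirectangle Z" and ZM: "Z \<subseteq> M"
      unfolding Z_def using Rec_subset[OF sD(1-3)] sD(2,3) by (auto intro: multirectangle_Un)
    have "measure lebesgue Z \<le> 2 * measure lebesgue X"
      unfolding Z_def using multirectangle_measure_Un_le[OF sD(2) Rec_subset(2)[OF sD(1-3)]]
        Rec_subset(4)[OF sD(1-3)] by linarith
    then have "measure lebesgue Z < measure lebesgue (R - Z)"
      using multirectangle_measure_Diff_ge[OF R(1) mZ] X(2) by linarith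
    \<comment> \<open>The image avoids \<open>Z\<close> so that the embedding extends to a
      flip.\<close>
    then obtain \<psi> where \<psi>: "piecewise_translation Z \<psi>" "inj_on \<psi> Z" "\<psi> ` Z \<subseteq> R - Z"
      by (rule piecewise_translation_embedding[OF mZ multirectangle_Diff[OF R(1) mZ]])
    obtain c where c: "flip Z c" "\<And>x. x \<in> Z \<Longrightarrow> c x = \<psi> x"
      by (rule ex_flip_extending[OF \<psi>(1,2) ZM]) (use \<psi>(3) R(3) in auto)
    have cT: "c \<in> flip_group" using c(1) by (rule flip_in_flip_group)
    have cR: "c \<in> Rec M" using cT by (rule flip_group_Rec)
    have aR: "a \<in> Rec M" and bR: "b \<in> Rec M" using a(1) b(1) by (simp_all add: flip_group_Rec)
    have cc: "c (c x) = x" for x using flipD(5)[OF c(1)] .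
    have ic: "?i c = c" by (rule Rec_inv_eqI[OF cR cR cc])
    have conj: "c \<circ> d \<circ> c \<in> derived (RecGroup M) (Rec M)" "x \<notin> R \<Longrightarrow> (c \<circ> d \<circ> c) x = x"
      if d: "d \<in> flip_group" "\<And>x. x \<notin> Z \<Longrightarrow> d x = x" for d x
    proof -
      have "c \<circ> d \<circ> c \<in> flip_group" using flips.inv_op_closed2[of c d] cR d(1) ic by simp
      then show "c \<circ> d \<circ> c \<in> derived (RecGroup M) (Rec M)" using flip_group_subset_derived by blast
      assume "x \<notin> R"
      have "c x \<notin> Z"
      proof
        assume "c x \<in> Z"
        then have "c (c x) \<in> R" using c(2) \<psi>(3) by auto
        with \<open>x \<notin> R\<close> cc show False by simp
      qed
      then show "(c \<circ> d \<circ> c) x = x" using d(2) cc by simp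
    qed
    have inv_conj: "?i (c \<circ> d \<circ> c) = c \<circ> ?i d \<circ> c" if d: "d \<in> Rec M" for d
      by (rule Rec_inv_eqI) (simp_all add: Rec_comp Rec_inv d cR cc)
    have "(c \<circ> a \<circ> c) \<circ> (c \<circ> b \<circ> c) \<circ> ?i (c \<circ> a \<circ> c) \<circ> ?i (c \<circ> b \<circ> c) \<in> H"
      using a b unfolding Z_def[symmetric]
      by (intro commutator_in_normalized[OF H(1) norm f(1) R(4)] conj)
    then have "c \<circ> ((c \<circ> a \<circ> c) \<circ> (c \<circ> b \<circ> c) \<circ> ?i (c \<circ> a \<circ> c) \<circ> ?i (c \<circ> b \<circ> c)) \<circ> ?i c \<in> H"
      using norm cT flip_group_subset_derived by blast
    moreover have "c \<circ> ((c \<circ> a \<circ> c) \<circ> (c \<circ> b \<circ> c) \<circ> ?i (c \<circ> a \<circ> c) \<circ> ?i (c \<circ> b \<circ> c)) \<circ> ?i c = s"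
      unfolding ic inv_conj[OF aR] inv_conj[OF bR] s_eq by (simp add: fun_eq_iff cc)
    ultimately show "s \<in> H" by simp
  qed
qed

section \<open>Containment, nontriviality and simplicity of the derived subgroup\<close>

lemma derived_subset_normalized:
  assumes "M \<noteq> {}" "subgroup H (RecGroup M)" "H \<noteq> {id}"
    and "\<And>g h. g \<in> derived (RecGroup M) (Rec M) \<Longrightarrow> h \<in> H \<Longrightarrow> g \<circ> h \<circ> inv\<^bsub>RecGroup M\<^esub> g \<in> H"
  shows "derived (RecGroup M) (Rec M) \<subseteq> H"
  using derived_subset_flip_group[OF assms(1)] flip_group_subset_normalized[OF assms(2-4)] by blast

lemma derived_nontrivial:
  assumes "M \<noteq> {}"
  shows "derived (RecGroup M) (Rec M) \<noteq> {id}"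
proof -
  obtain U s where U: "U \<noteq> {}" "flip U s" using assms by (rule ex_nonempty_flip)
  then obtain x where "x \<in> U" "s x \<noteq> x" using flipD(4)[OF U(2)] by force
  then have "s \<noteq> id" by auto
  moreover have "s \<in> derived (RecGroup M) (Rec M)"
    using flip_in_flip_group[OF U(2)] flip_group_subset_derived by blast
  ultimately show ?thesis by blast
qed

text \<open>A normal subgroup of the derived subgroup is not known to be normal in the whole group,
  but it is normalized by the derived subgroup, which is exactly what
  \<open>derived_subset_normalized\<close> asks for.\<close>

lemma simple_derived:
  assumes "M \<noteq> {}"
  shows "simple_grp ((RecGroup M)\<lparr>carrier := derived (RecGroup M) (Rec M)\<rparr>)"
    (is "simple_grp (_\<lparr>carrier := ?D\<rparr>)")
  unfolding simple_grp_def
proof (intro conjI allI impI)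
  show "group ((RecGroup M)\<lparr>carrier := ?D\<rparr>)" using derived_subgroup by (rule subgroup_imp_group)
  show "carrier ((RecGroup M)\<lparr>carrier := ?D\<rparr>) \<noteq> {\<one>\<^bsub>(RecGroup M)\<lparr>carrier := ?D\<rparr>\<^esub>}"
    using derived_nontrivial[OF assms] by simp
  fix N assume N: "N \<lhd> (RecGroup M)\<lparr>carrier := ?D\<rparr>"
  have sub: "subgroup N ((RecGroup M)\<lparr>carrier := ?D\<rparr>)" using N by (rule normal_imp_subgroup)
  have "g \<circ> h \<circ> inv\<^bsub>RecGroup M\<^esub> g \<in> N" if "g \<in> ?D" "h \<in> N" for g h
    using normal.inv_op_closed2[OF N, of g h] that m_inv_consistent[OF derived_subgroup that(1)] by simp
  then have "?D \<subseteq> N" if "N \<noteq> {id}"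
    using derived_subset_normalized[OF assms incl_subgroup[OF derived_subgroup sub] that] by blast
  moreover have "N \<subseteq> ?D" using subgroup.subset[OF sub] by simp
  ultimately show "N = {\<one>\<^bsub>(RecGroup M)\<lparr>carrier := ?D\<rparr>\<^esub>} \<or> N = carrier ((RecGroup M)\<lparr>carrier := ?D\<rparr>)"
    by auto
qed

end

theorem mainTheorem3:
  fixes M :: "(real^'n) set"
  assumes "multirectangle M" and "M \<noteq> {}"
  shows "(\<forall>H. subgroup H (RecGroup M) \<and> H \<noteq> {id} \<and>
            (\<forall>g\<in>derived (RecGroup M) (Rec M). \<forall>h\<in>H. g \<circ> h \<circ> inv\<^bsub>RecGroup M\<^esub> g \<in> H)
            \<longrightarrow> derived (RecGroup M) (Rec M) \<subseteq> H)
    \<and> simple_grp ((RecGroup M)\<lparr>carrier := derived (RecGroup M) (Rec M)\<rparr>)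
    \<and> (\<forall>N. N \<lhd> RecGroup M \<and> N \<noteq> {id} \<longrightarrow> derived (RecGroup M) (Rec M) \<subseteq> N)"
proof -
  interpret rectangle_exchange M by unfold_locales (rule assms(1))
  show ?thesis
  proof (intro conjI allI impI; (elim conjE)?)
    fix H assume "subgroup H (RecGroup M)" "H \<noteq> {id}"
      "\<forall>g\<in>derived (RecGroup M) (Rec M). \<forall>h\<in>H. g \<circ> h \<circ> inv\<^bsub>RecGroup M\<^esub> g \<in> H"
    then show "derived (RecGroup M) (Rec M) \<subseteq> H"
      using derived_subset_normalized[OF assms(2)] by simp
  next
    show "simple_grp ((RecGroup M)\<lparr>carrier := derived (RecGroup M) (Rec M)\<rparr>)"
      using assms(2) by (rule simple_derived)
  next
    fix N assume N: "N \<lhd> RecGroup M" "N \<noteq> {id}"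
    have "g \<circ> h \<circ> inv\<^bsub>RecGroup M\<^esub> g \<in> N" if "g \<in> derived (RecGroup M) (Rec M)" "h \<in> N" for g h
      using normal.inv_op_closed2[OF N(1), of g h] that subgroup.mem_carrier[OF derived_subgroup that(1)]
      by simp
    then show "derived (RecGroup M) (Rec M) \<subseteq> N"
      using derived_subset_normalized[OF assms(2) normal_imp_subgroup[OF N(1)] N(2)] by blast
  qed
qed

end
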